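(* Let $n\ge 1$ be an integer, $0<\gamma<n$, $1<p<n/\gamma$, $1/q=1/p-\gamma/n$ and $w\in A_{p,q}$. Assume that $p\le\alpha<\beta<s\le\infty$ with $1/\beta=1/\alpha-\gamma/n$, and that $\mu\in\Delta_2$. Then the fractional maximal operator $M_\gamma$ is bounded from $(L^p,L^s)^{\alpha}(w^p,w^q;\mu)$ into $(L^q,L^s)^{\beta}(w^q;\mu)$; that is, there is a constant $C>0$ independent of $f$ such that $\|M_\gamma f\|_{(L^q,L^s)^{\beta}(w^q;\mu)}\le C\|f\|_{(L^p,L^s)^{\alpha}(w^p,w^q;\mu)}$ for all $f\in(L^p,L^s)^{\alpha}(w^p,w^q;\mu)$.
   Context: A weight is a non-negative locally integrable function on $\mathbb R^n$; for a weight $w$ and measurable $E$, $w(E)=\int_E w(x)\,dx$, and $w^q(E)=\int_E w(x)^q\,dx$. $B(y,r)$ is the open Euclidean ball with center $y$ and radius $r$; $p'=p/(p-1)$. Fractional maximal operator: $M_\gamma f(x)=\sup_{B\ni x}\frac1{|B|^{1-\gamma/n}}\int_B|f(y)|\,dy$, the supremum over all balls $B$ containing $x$. For $1<p,q<\infty$, $w\in A_{p,q}$ means: there is $C>0$ such that for every ball $B$, $\left(\frac1{|B|}\int_B w^q\,dx\right)^{1/q}\left(\frac1{|B|}\int_B w^{-p'}\,dx\right)^{1/p'}\le C$. $\mu\in\Delta_2$ means that $\mu$ is a weight and there is $C>0$ with $\mu(2B)\le C\mu(B)$ for every ball $B$ ($2B$ is the concentric ball with twice the radius). Weighted amalgam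 spaces: for $1\le p\le\alpha\le s\le\infty$ and weights $\nu,w,\mu$, the space $(L^p,L^s)^{\alpha}(\nu,w;\mu)$ consists of all locally integrable $f$ with $$\|f\|_{(L^p,L^s)^{\alpha}(\nu,w;\mu)}:=\sup_{r>0}\Big\|w(B(y,r))^{1/\alpha-1/p-1/s}\,\|f\chi_{B(y,r)}\|_{L^p(\nu)}\Big\|_{L^s(\mu)}<\infty,$$ where the $L^s(\mu)$-norm (norm with respect to $\mu(y)\,dy$, usual modification when $s=\infty$) is taken in $y$, and $\|g\|_{L^p(\nu)}=(\int|g|^p\nu\,dx)^{1/p}$. One writes $(L^p,L^s)^{\alpha}(w;\mu):=(L^p,L^s)^{\alpha}(w,w;\mu)$. *)

theory Defs
  imports "HOL-Analysis.Analysis" "HOL-Probability.Essential_Supremum"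
begin

definition locally_integrable :: "(real ^ 'n \<Rightarrow> real) \<Rightarrow> bool" where
  "locally_integrable f \<longleftrightarrow> (\<forall>K. compact K \<longrightarrow> f absolutely_integrable_on K)"

definition weight :: "(real ^ 'n \<Rightarrow> real) \<Rightarrow> bool" where
  "weight w \<longleftrightarrow> (\<forall>x. 0 \<le> w x) \<and> locally_integrable w"

text \<open>The measure with density \<open>w\<close>: the weight of a set \<open>E\<close> is
  \<open>emeasure (weight_measure w) E\<close>.\<close>

definition weight_measure :: "(real ^ 'n \<Rightarrow> real) \<Rightarrow> (real ^ 'n) measure" where
  "weight_measure w = density lebesgue (\<lambda>x. ennreal (w x))"

text \<open>Real powers of extended nonnegative numbers, with the conventions of analysis: a negative
  power of \<open>0\<close> is \<open>\<infinity>\<close> (whereas \<open>0 powr a = 0\<close> for reals), and \<open>x\<close> to the power \<open>0\<close> is \<open>1\<close>.\<close>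

definition epowr :: "ennreal \<Rightarrow> real \<Rightarrow> ennreal" where
  "epowr x a =
    (if a = 0 then 1
     else if x = 0 then (if 0 < a then 0 else \<infinity>)
     else if x = \<infinity> then (if 0 < a then \<infinity> else 0)
     else ennreal (enn2real x powr a))"

text \<open>The norm of \<open>L\<^sup>s(M)\<close>, for exponents \<open>0 < s \<le> \<infinity>\<close>, of a function already replaced by
  its absolute value; it takes the value \<open>\<infinity>\<close> outside \<open>L\<^sup>s(M)\<close>.\<close>

definition Lnorm :: "ereal \<Rightarrow> 'a measure \<Rightarrow> ('a \<Rightarrow> ennreal) \<Rightarrow> ennreal" where
  "Lnorm s M g =
    (if s = \<infinity> then esssup M g
     else epowr (\<integral>\<^sup>+x. epowr (g x) (real_of_ereal s) \<partial>M) (1 / real_of_ereal s))"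

definition frac_maximal :: "real \<Rightarrow> (real ^ 'n \<Rightarrow> real) \<Rightarrow> real ^ 'n \<Rightarrow> ennreal" where
  "frac_maximal \<gamma> f x =
    (SUP (c, r) \<in> {(c, r). 0 < r \<and> x \<in> ball c r}.
       (\<integral>\<^sup>+y\<in>ball c r. ennreal \<bar>f y\<bar> \<partial>lebesgue)
         / epowr (emeasure lebesgue (ball c r)) (1 - \<gamma> / real CARD('n)))"

text \<open>The integrals below are extended-valued, and \<open>w\<close> to the power \<open>-p'\<close> is \<open>\<infinity>\<close> where \<open>w\<close>
  vanishes. Hence a member of the class that vanishes on a set of positive measure vanishes
  almost everywhere.\<close>

definition A_class :: "real \<Rightarrow> real \<Rightarrow> (real ^ 'n \<Rightarrow> real) \<Rightarrow> bool" where
  "A_class p q w \<longleftrightarrow> weight w \<and>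
    (let p' = p / (p - 1) in
      \<exists>C::real>0. \<forall>c r. 0 < r \<longrightarrow>
        epowr ((\<integral>\<^sup>+x\<in>ball c r. epowr (ennreal (w x)) q \<partial>lebesgue)
                 / emeasure lebesgue (ball c r)) (1 / q)
        * epowr ((\<integral>\<^sup>+x\<in>ball c r. epowr (ennreal (w x)) (- p') \<partial>lebesgue)
                 / emeasure lebesgue (ball c r)) (1 / p')
        \<le> ennreal C)"

definition doubling_weight :: "(real ^ 'n \<Rightarrow> real) \<Rightarrow> bool" where
  "doubling_weight \<mu> \<longleftrightarrow> weight \<mu> \<and>
    (\<exists>C::real>0. \<forall>c r. 0 < r \<longrightarrow>
       emeasure (weight_measure \<mu>) (ball c (2 * r))
         \<le> ennreal C * emeasure (weight_measure \<mu>) (ball c r))"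

text \<open>The amalgam norm depends only on the absolute value, so it is defined on
  \<open>ennreal\<close>-valued functions; this lets it apply to maximal functions, which may be infinite.
  The argument order \<open>p s \<alpha> \<nu> w \<mu>\<close> is that of \<open>(L\<^sup>p, L\<^sup>s)\<^sup>\<alpha>(\<nu>, w; \<mu>)\<close>. Only finite \<open>p\<close> and
  \<open>\<alpha>\<close> are covered; \<open>real_of_ereal (1 / s)\<close> is \<open>0\<close> for \<open>s = \<infinity>\<close>.\<close>

definition amalgam_norm ::
  "real \<Rightarrow> ereal \<Rightarrow> real \<Rightarrow> (real ^ 'n \<Rightarrow> real) \<Rightarrow> (real ^ 'n \<Rightarrow> real) \<Rightarrow> (real ^ 'n \<Rightarrow> real)
    \<Rightarrow> (real ^ 'n \<Rightarrow> ennreal) \<Rightarrow> ennreal" where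
  "amalgam_norm p s \<alpha> \<nu> w \<mu> g =
    (SUP r\<in>{0<..}.
       Lnorm s (weight_measure \<mu>)
         (\<lambda>y. epowr (emeasure (weight_measure w) (ball y r)) (1 / \<alpha> - 1 / p - real_of_ereal (1 / s))
              * Lnorm (ereal p) (weight_measure \<nu>) (\<lambda>x. g x * indicator (ball y r) x)))"

definition amalgam_space ::
  "real \<Rightarrow> ereal \<Rightarrow> real \<Rightarrow> (real ^ 'n \<Rightarrow> real) \<Rightarrow> (real ^ 'n \<Rightarrow> real) \<Rightarrow> (real ^ 'n \<Rightarrow> real)
    \<Rightarrow> (real ^ 'n \<Rightarrow> real) set" where
  "amalgam_space p s \<alpha> \<nu> w \<mu> =
    {f. locally_integrable f \<and> amalgam_norm p s \<alpha> \<nu> w \<mu> (\<lambda>x. ennreal \<bar>f x\<bar>) < \<infinity>}"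

end

theory Submission
  imports Defs
begin

text \<open>Write \<open>U\<close>, \<open>V\<close>, \<open>W\<close> for the measures with densities \<open>w\<close> to the powers \<open>q\<close>, \<open>-p'\<close> and \<open>p\<close>.
  The class condition makes \<open>U\<close> and \<open>V\<close> doubling and \<open>U\<close> reverse doubling, and doubling
  measures have maximal operators of strong type by the Vitali covering lemma. Dominating the
  fractional maximal function pointwise by a composition of the maximal operators of \<open>V\<close> and \<open>U\<close>
  gives its boundedness from \<open>L\<^sup>p(W)\<close> to \<open>L\<^sup>q(U)\<close>.

  For the amalgam norm fix a ball \<open>B\<close> of radius \<open>r\<close>. Balls meeting \<open>B\<close> are either contained in \<open>2B\<close>,
  where the strong type inequality applies, or contained in a dilate \<open>2\<^sup>kB\<close> of comparable
  volume, where Hoelder's inequality bounds the average. Reverse doubling turns the ratio \<open>U(B) / U(2\<^sup>kB)\<close>, raised to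
  \<open>1/\<beta> - 1/s > 0\<close>, into a geometric factor, so the supremum over \<open>k\<close> is bounded in \<open>L\<^sup>s\<close> by a
  convergent geometric series times the norm of \<open>f\<close>.\<close>

subsection \<open>Real powers in the extended nonnegative reals\<close>

text \<open>The relations between the exponents give 1/\<alpha> - 1/p = 1/\<beta> - 1/q, so both
  amalgam norms weight a ball by the same power e = 1/\<alpha> - 1/p - 1/s of its
  \<open>U\<close>-measure. The q-th root of the estimate on a ball contributes a further 1/q, and e
  + 1/q = 1/\<beta> - 1/s is the exponent on which reverse doubling acts; its positivity is the
  hypothesis \<beta> < s. The dilates keep the centre y of the ball, so the k-th term is exactly the
  function of y that the norm of f measures at radius 2^(k+1) r; the supremum over radii bounds all
  these terms by one number, and only the decay in k is left to sum.

  The class condition is extended-valued and also admits weights that vanish almost everywhere, for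
  which the negative power has infinite integral over every ball. That case is split off: there the
  norm of the maximal function is 0. In the other case all ball masses are positive and finite, and
  the argument can be carried out with real numbers.\<close>

lemma epowr_zero [simp]: "0 < a \<Longrightarrow> epowr 0 a = 0"
  by (simp add: epowr_def)

lemma epowr_top [simp]: "0 < a \<Longrightarrow> epowr \<infinity> a = \<infinity>" "0 < a \<Longrightarrow> epowr top a = top"
  by (simp_all add: epowr_def infinity_ennreal_def)

lemma epowr_zero_exponent [simp]: "epowr x 0 = 1"
  by (simp add: epowr_def)

lemma epowr_ennreal: "0 < a \<Longrightarrow> 0 \<le> x \<Longrightarrow> epowr (ennreal x) a = ennreal (x powr a)"
  by (auto simp: epowr_def)

lemma epowr_ennreal_pos: "0 < x \<Longrightarrow> epowr (ennreal x) a = ennreal (x powr a)"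
  by (auto simp: epowr_def)

lemma epowr_one [simp]: "epowr x 1 = x"
  by (cases x) (auto simp: epowr_ennreal)

lemma epowr_mono:
  assumes "0 \<le> a" "x \<le> y"
  shows "epowr x a \<le> epowr y a"
proof (cases "a = 0")
  case False
  then have "0 < a" using assms by simp
  then show ?thesis using assms
    by (cases x; cases y) (auto simp: epowr_ennreal intro!: ennreal_leI powr_mono2 simp: top_unique)
qed simp

text \<open>Negative exponents are excluded by 0 * \<infinity> = 0: for x = 0 and y = \<infinity>
  the left side would be \<infinity> and the right side 0.\<close>

lemma epowr_mult:
  assumes "0 \<le> a"
  shows "epowr (x * y) a = epowr x a * epowr y a"
proof (cases "a = 0")
  case False
  then have a: "0 < a" using assms by simp
  show ?thesis
  proof (cases "x = 0 \<or> y = 0")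
    case True then show ?thesis using a by auto
  next
    case False
    then show ?thesis using a
      by (cases x; cases y)
        (auto simp: epowr_ennreal ennreal_mult[symmetric] powr_mult ennreal_mult_top ennreal_top_mult epowr_ennreal_pos)
  qed
qed simp

text \<open>A positive inner power fixes both 0 and \<infinity>, so the outer exponent may have any
  sign.\<close>

lemma epowr_epowr:
  assumes "0 < a"
  shows "epowr (epowr x a) b = epowr x (a * b)"
proof (cases "x = 0 \<or> x = \<infinity>")
  case True then show ?thesis using assms by (auto simp: epowr_def zero_less_mult_iff infinity_ennreal_def)
next
  case False
  then obtain z where "x = ennreal z" "0 < z"
    by (cases x) (auto simp: infinity_ennreal_def)
  then show ?thesis by (simp add: epowr_ennreal_pos powr_powr)
qed

lemma epowr_add:
  assumes "0 \<le> a" "0 \<le> b"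
  shows "epowr x (a + b) = epowr x a * epowr x b"
proof (cases "a = 0 \<or> b = 0")
  case False
  then have "0 < a" "0 < b" using assms by auto
  then show ?thesis
    by (cases x) (auto simp: epowr_ennreal powr_add ennreal_mult)
qed auto

text \<open>The powers \<open>a\<close> and \<open>1 / a\<close> are mutually inverse monotone maps.
  This adjunction makes powers commute with arbitrary suprema, without a continuity
  argument.\<close>

lemma epowr_le_iff:
  assumes "0 < a"
  shows "epowr x a \<le> y \<longleftrightarrow> x \<le> epowr y (1 / a)"
  using assms epowr_mono[of "1/a" "epowr x a" y] epowr_mono[of a x "epowr y (1/a)"]
  by (auto simp: epowr_epowr)

lemma epowr_SUP:
  assumes "0 < a"
  shows "epowr (SUP i\<in>I. f i) a = (SUP i\<in>I. epowr (f i) a)"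
proof (rule antisym)
  show "epowr (SUP i\<in>I. f i) a \<le> (SUP i\<in>I. epowr (f i) a)"
    unfolding epowr_le_iff[OF assms] SUP_le_iff
    by (metis SUP_upper epowr_le_iff assms)
  show "(SUP i\<in>I. epowr (f i) a) \<le> epowr (SUP i\<in>I. f i) a"
    by (intro SUP_least epowr_mono SUP_upper) (use assms in auto)
qed

lemma epowr_measurable [measurable]: "(\<lambda>x. epowr x a) \<in> borel_measurable borel"
  unfolding epowr_def by measurable

section \<open>Young's and Hoelder's inequalities and the layer cake formula\<close>

lemma weighted_am_gm_ennreal:
  assumes "0 < t" "t < 1"
  shows "epowr x t * epowr y (1 - t) \<le> ennreal t * x + ennreal (1 - t) * y"
proof (cases "x = 0 \<or> y = 0 \<or> x = \<infinity> \<or> y = \<infinity>")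
  case True then show ?thesis using assms by (auto simp: ennreal_mult_top)
next
  case False
  then obtain a b where ab: "x = ennreal a" "0 < a" "y = ennreal b" "0 < b"
    by (cases x; cases y) (auto simp: infinity_ennreal_def)
  then show ?thesis using assms Youngs_inequality_0[of t "1-t" a b]
    by (simp add: epowr_ennreal_pos ennreal_mult[symmetric] ennreal_plus[symmetric] del: ennreal_plus)
qed

text \<open>Hoelder's inequality with conjugate exponents 1/t and 1/(1-t), stated through powers of
  integrals so that values in [0, \<infinity>] need no case distinction at the points of
  use.\<close>

lemma Holder_nn_integral:
  assumes [measurable]: "F \<in> borel_measurable M" "G \<in> borel_measurable M"
    and t: "0 < t" "t < 1"
  shows "(\<integral>\<^sup>+x. epowr (F x) t * epowr (G x) (1 - t) \<partial>M)
    \<le> epowr (\<integral>\<^sup>+x. F x \<partial>M) t * epowr (\<integral>\<^sup>+x. G x \<partial>M) (1 - t)"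
proof -
  define A where "A = (\<integral>\<^sup>+x. F x \<partial>M)"
  define B where "B = (\<integral>\<^sup>+x. G x \<partial>M)"
  consider "A = 0" | "B = 0" | "A \<noteq> 0" "B \<noteq> 0" "A = \<infinity> \<or> B = \<infinity>" | a b where
    "A = ennreal a" "0 < a" "B = ennreal b" "0 < b"
    by (cases A rule: ennreal_cases; cases B rule: ennreal_cases)
      (auto simp: infinity_ennreal_def less_le)
  then show ?thesis
  proof cases
    case 1
    then have "AE x in M. F x = 0" by (simp add: A_def nn_integral_0_iff_AE)
    then have "(\<integral>\<^sup>+x. epowr (F x) t * epowr (G x) (1 - t) \<partial>M) = (\<integral>\<^sup>+x. 0 \<partial>M)"
      by (intro nn_integral_cong_AE) (auto simp: t)
    then show ?thesis by simp
  next
    case 2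
    then have "AE x in M. G x = 0" by (simp add: B_def nn_integral_0_iff_AE)
    then have "(\<integral>\<^sup>+x. epowr (F x) t * epowr (G x) (1 - t) \<partial>M) = (\<integral>\<^sup>+x. 0 \<partial>M)"
      by (intro nn_integral_cong_AE) (auto simp: t)
    then show ?thesis by simp
  next
    case 3
    then have "epowr A t * epowr B (1 - t) = \<infinity>" using t
      by (auto simp: epowr_def ennreal_mult_eq_top_iff infinity_ennreal_def enn2real_eq_0_iff)
    then show ?thesis by (simp add: A_def B_def)
  next
    case 4
    \<comment> \<open>Young's inequality for F/a and G/b: after this normalisation the right side
      integrates to t + (1 - t) = 1 times the product of the powers of \<open>a\<close> and
      \<open>b\<close>.\<close>
    have "epowr (F x) t * epowr (G x) (1 - t)
      \<le> ennreal (a powr t * b powr (1-t)) * (ennreal (t/a) * F x + ennreal ((1-t)/b) * G x)" for x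
    proof -
      have F: "F x = ennreal a * (ennreal (1/a) * F x)"
        using 4 by (simp add: mult.assoc[symmetric] ennreal_mult[symmetric])
      have G: "G x = ennreal b * (ennreal (1/b) * G x)"
        using 4 by (simp add: mult.assoc[symmetric] ennreal_mult[symmetric])
      have "epowr (F x) t * epowr (G x) (1 - t) = ennreal (a powr t * b powr (1-t))
         * (epowr (ennreal (1/a) * F x) t * epowr (ennreal (1/b) * G x) (1 - t))"
        by (subst F, subst G) (use 4 t in \<open>simp add: epowr_mult epowr_ennreal_pos ennreal_mult mult_ac\<close>)
      also have "\<dots> \<le> ennreal (a powr t * b powr (1-t)) *
          (ennreal t * (ennreal (1/a) * F x) + ennreal (1-t) * (ennreal (1/b) * G x))"
        by (intro mult_left_mono weighted_am_gm_ennreal t) auto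
      also have "\<dots> = ennreal (a powr t * b powr (1-t)) * (ennreal (t/a) * F x + ennreal ((1-t)/b) * G x)"
        using 4 t by (simp add: mult.assoc[symmetric] ennreal_mult[symmetric])
      finally show ?thesis .
    qed
    then have "(\<integral>\<^sup>+x. epowr (F x) t * epowr (G x) (1 - t) \<partial>M) \<le>
       (\<integral>\<^sup>+x. ennreal (a powr t * b powr (1-t)) * (ennreal (t/a) * F x + ennreal ((1-t)/b) * G x) \<partial>M)"
      by (intro nn_integral_mono) simp
    also have "\<dots> = ennreal (a powr t * b powr (1-t)) * (ennreal (t/a) * A + ennreal ((1-t)/b) * B)"
      by (simp add: nn_integral_cmult nn_integral_add A_def B_def)
    also have "ennreal (t/a) * A + ennreal ((1-t)/b) * B = 1"
      using 4 t by (simp add: ennreal_mult[symmetric] ennreal_plus[symmetric] del: ennreal_plus)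
    also have "ennreal (a powr t * b powr (1-t)) * 1 = epowr A t * epowr B (1-t)"
      using 4 by (simp add: epowr_ennreal_pos ennreal_mult)
    finally show ?thesis by (simp add: A_def B_def)
  qed
qed

text \<open>The power is written as an integral over levels below \<open>x\<close>, so that Fubini
  converts bounds on superlevel sets into bounds on integrals of powers. For finite \<open>x\<close>
  it is the antiderivative of a t^(a-1); for \<open>x = top\<close> the integral exceeds every n by
  comparison with a finite level.\<close>

lemma epowr_layer_cake:
  assumes a: "0 < a"
  shows "epowr x a = (\<integral>\<^sup>+t. ennreal (a * t powr (a - 1)) * indicator {t. 0 < t \<and> ennreal t < x} t \<partial>lborel)"
proof -
  have fin: "epowr (ennreal c) a =
     (\<integral>\<^sup>+t. ennreal (a * t powr (a - 1)) * indicator {t. 0 < t \<and> t < c} t \<partial>lborel)"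
    if c: "0 \<le> c" for c
  proof -
    have "((\<lambda>t. a * t powr (a-1)) has_integral (a * (c powr (a-1+1) / (a-1+1)))) {0..c}"
      by (intro has_integral_mult_right has_integral_powr_from_0) (use a c in auto)
    then have "((\<lambda>t. a * t powr (a-1)) has_integral (c powr a)) {0..c}" using a by simp
    then have "integral\<^sup>N lborel (\<lambda>t. ennreal (indicator {0..c} t * (a * t powr (a-1)))) = ennreal (c powr a)"
      by (intro nn_integral_has_integral_lebesgue) (use a in auto)
    moreover have "integral\<^sup>N lborel (\<lambda>t. ennreal (indicator {0..c} t * (a * t powr (a-1)))) =
      (\<integral>\<^sup>+t. ennreal (a * t powr (a - 1)) * indicator {t. 0 < t \<and> t < c} t \<partial>lborel)"
    proof (rule nn_integral_cong_AE)
      have "AE t in lborel. t \<noteq> 0 \<and> t \<noteq> c"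
        by (intro AE_conjI AE_lborel_singleton)
      then show "AE t in lborel. ennreal (indicator {0..c} t * (a * t powr (a-1))) =
         ennreal (a * t powr (a - 1)) * indicator {t. 0 < t \<and> t < c} t"
        by eventually_elim (auto simp: indicator_def)
    qed
    ultimately show ?thesis using a c by (simp add: epowr_ennreal)
  qed
  show ?thesis
  proof (cases x)
    case (real c)
    then have "{t. 0 < t \<and> ennreal t < x} = {t. 0 < t \<and> t < c}" by (auto simp: ennreal_less_iff)
    then show ?thesis using fin[of c] real by simp
  next
    case top
    have "ennreal (real n) \<le>
      (\<integral>\<^sup>+t. ennreal (a * t powr (a - 1)) * indicator {t. 0 < t \<and> ennreal t < x} t \<partial>lborel)" for n :: nat
    proof -
      have "ennreal (real n) = epowr (ennreal (real n powr (1/a))) a"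
        using a by (simp add: epowr_ennreal powr_powr)
      also have "\<dots> \<le> (\<integral>\<^sup>+t. ennreal (a * t powr (a - 1)) * indicator {t. 0 < t \<and> ennreal t < x} t \<partial>lborel)"
        unfolding fin[OF powr_ge_zero]
        by (intro nn_integral_mono mult_left_mono) (auto simp: indicator_def top)
      finally show ?thesis .
    qed
    then have "(SUP n. of_nat n) \<le>
      (\<integral>\<^sup>+t. ennreal (a * t powr (a - 1)) * indicator {t. 0 < t \<and> ennreal t < x} t \<partial>lborel)"
      by (intro SUP_least) (simp add: ennreal_of_nat_eq_real_of_nat)
    then have "(\<integral>\<^sup>+t. ennreal (a * t powr (a - 1)) * indicator {t. 0 < t \<and> ennreal t < x} t \<partial>lborel) = top"
      by (simp add: ennreal_SUP_of_nat_eq_top top_unique)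
    then show ?thesis using a top by simp
  qed
qed

subsection \<open>Maximal functions for doubling measures\<close>

lemma ennreal_divide_le_iff:
  fixes b :: ennreal
  assumes "e \<noteq> 0" "e \<noteq> \<infinity>"
  shows "b / e \<le> t \<longleftrightarrow> b \<le> t * e"
proof
  assume "b / e \<le> t"
  then have "b / e * e \<le> t * e" by (rule mult_right_mono) simp
  then show "b \<le> t * e" using assms by (simp add: ennreal_divide_times ennreal_divide_self infinity_ennreal_def top.not_eq_extremum)
next
  assume "b \<le> t * e"
  then show "b / e \<le> t" using assms
    by (intro divide_le_posI_ennreal) (auto simp: mult.commute zero_less_iff_neq_zero)
qed

lemma ennreal_divide_ennreal:
  assumes "0 < d" shows "x / ennreal d = ennreal (1 / d) * x"
  using assms by (simp add: divide_ennreal_def inverse_ennreal inverse_eq_divide mult.commute)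

text \<open>Balls containing x need not be centred at x, so each superlevel set is a union of open
  balls and hence open, whatever \<Phi> is.\<close>

lemma ball_sup_measurable:
  fixes \<Phi> :: "'a::metric_space \<Rightarrow> real \<Rightarrow> ennreal"
  shows "(\<lambda>x. SUP (c, r)\<in>{(c, r). 0 < r \<and> x \<in> ball c r}. \<Phi> c r) \<in> borel_measurable borel"
proof (rule borel_measurableI_greater)
  fix a
  have "{x \<in> space borel. a < (SUP (c, r)\<in>{(c, r). 0 < r \<and> x \<in> ball c r}. \<Phi> c r)} =
     (\<Union>(c, r)\<in>{(c, r). 0 < r \<and> a < \<Phi> c r}. ball c r)"
    by (simp add: less_SUP_iff set_eq_iff) blast
  moreover have "open (\<Union>(c, r)\<in>{(c, r). 0 < r \<and> a < \<Phi> c r}. ball c r)"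
    by (intro open_UN) auto
  ultimately show "{x \<in> space borel. a < (SUP (c, r)\<in>{(c, r). 0 < r \<and> x \<in> ball c r}. \<Phi> c r)} \<in> sets borel"
    by simp
qed

text \<open>The uncentred form matters: the average over a ball bounds this function at every point
  of the ball, which is used in the pointwise domination of the fractional operator.\<close>

definition weighted_maximal :: "'a::metric_space measure \<Rightarrow> ('a \<Rightarrow> ennreal) \<Rightarrow> 'a \<Rightarrow> ennreal" where
  "weighted_maximal \<nu> g x = (SUP (c, r)\<in>{(c, r). 0 < r \<and> x \<in> ball c r}.
     (\<integral>\<^sup>+y\<in>ball c r. g y \<partial>\<nu>) / emeasure \<nu> (ball c r))"

lemma weighted_maximal_borel: "weighted_maximal \<nu> g \<in> borel_measurable borel"
  unfolding weighted_maximal_def[abs_def] by (rule ball_sup_measurable)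

text \<open>The sigma-algebra is that of Lebesgue measurable sets because the weights are only
  Lebesgue measurable; positive finite ball masses make the averages genuine quotients.\<close>

locale doubling_measure =
  fixes \<nu> :: "'a::euclidean_space measure" and D :: real
  assumes sets_eq: "sets \<nu> = sets lebesgue"
    and ball_pos: "0 < r \<Longrightarrow> emeasure \<nu> (ball c r) \<noteq> 0"
    and ball_fin: "0 < r \<Longrightarrow> emeasure \<nu> (ball c r) \<noteq> \<infinity>"
    and doubling: "0 < r \<Longrightarrow> emeasure \<nu> (ball c (2 * r)) \<le> ennreal D * emeasure \<nu> (ball c r)"
begin

lemma space_eq [simp]: "space \<nu> = UNIV"
  using sets_eq_imp_space_eq[OF sets_eq] by simp

lemma borel_measurable_imp:
  "f \<in> borel_measurable borel \<Longrightarrow> f \<in> borel_measurable \<nu>"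
  by (simp add: measurable_cong_sets[OF sets_eq refl] measurable_completion)

lemma borel_sets: "A \<in> sets borel \<Longrightarrow> A \<in> sets \<nu>"
  by (simp add: sets_eq)

lemma weighted_maximal_measurable [measurable]: "weighted_maximal \<nu> g \<in> borel_measurable \<nu>"
  by (intro borel_measurable_imp weighted_maximal_borel)

lemma sigma_finite: "sigma_finite_measure \<nu>"
proof
  show "\<exists>A. countable A \<and> A \<subseteq> sets \<nu> \<and> \<Union> A = space \<nu> \<and> (\<forall>a\<in>A. emeasure \<nu> a \<noteq> \<infinity>)"
  proof (intro exI conjI)
    let ?A = "range (\<lambda>n. ball (0::'a) (real (Suc n)))"
    show "\<Union> ?A = space \<nu>"
    proof -
      have "\<exists>n. x \<in> ball 0 (real (Suc n))" for x :: 'a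
      proof -
        obtain n where "norm x < real n" using reals_Archimedean2 by blast
        then have "x \<in> ball 0 (real (Suc n))" by simp
        then show ?thesis ..
      qed
      then show ?thesis by auto
    qed
    show "\<forall>a\<in>?A. emeasure \<nu> a \<noteq> \<infinity>" using ball_fin[of "real (Suc n)" 0 for n] by auto
  qed (auto intro: borel_sets)
qed

text \<open>The factor 5 is the dilation in the Vitali covering lemma, and 5 \<le> 2^3 costs three
  doublings.\<close>

lemma ball_dilate_5:
  assumes "0 < r" shows "emeasure \<nu> (ball c (5 * r)) \<le> ennreal D ^ 3 * emeasure \<nu> (ball c r)"
proof -
  have "emeasure \<nu> (ball c (5 * r)) \<le> emeasure \<nu> (ball c (2 * (2 * (2 * r))))"
    using assms by (intro emeasure_mono subset_ball) (auto intro: borel_sets)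
  also have "\<dots> \<le> ennreal D * (ennreal D * (ennreal D * emeasure \<nu> (ball c r)))"
    by (rule order.trans[OF doubling mult_left_mono[OF order.trans[OF doubling mult_left_mono[OF doubling]]]])
      (use assms in auto)
  finally show ?thesis by (simp add: power3_eq_cube mult.assoc)
qed

section \<open>Weak type (1,1) and strong type by interpolation\<close>

lemma superlevel_eq:
  "{x. t < weighted_maximal \<nu> g x} =
   (\<Union>(c, r)\<in>{(c, r). 0 < r \<and> t * emeasure \<nu> (ball c r) < (\<integral>\<^sup>+y\<in>ball c r. g y \<partial>\<nu>)}. ball c r)"
proof -
  have "t < b / emeasure \<nu> (ball c r) \<longleftrightarrow> t * emeasure \<nu> (ball c r) < b" if "0 < r" for b c and r::real
    using ball_pos[OF that, of c] ball_fin[OF that, of c]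
    by (simp add: ennreal_divide_le_iff not_le[symmetric])
  then show ?thesis unfolding weighted_maximal_def by (simp add: less_SUP_iff set_eq_iff) blast
qed

lemma superlevel_sets: "{x. t < weighted_maximal \<nu> g x} \<in> sets \<nu>"
proof -
  have "{x \<in> space \<nu>. t < weighted_maximal \<nu> g x} \<in> sets \<nu>" by measurable
  then show ?thesis by simp
qed

text \<open>Vitali selects disjoint balls whose fivefold dilates cover the superlevel set. On each
  selected ball the integral of g exceeds t times the mass, and disjointness lets these integrals
  add up to at most the full integral.\<close>

lemma weak_type:
  assumes [measurable]: "g \<in> borel_measurable \<nu>"
  shows "t * emeasure \<nu> {x. t < weighted_maximal \<nu> g x} \<le> ennreal D ^ 3 * (\<integral>\<^sup>+x. g x \<partial>\<nu>)"
proof -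
  \<comment> \<open>Vitali's lemma needs bounded radii; the bound \<open>R\<close> is removed at the
    end by continuity from below.\<close>
  define K where "K R = {(c, r). 0 < r \<and> r \<le> real R \<and>
    t * emeasure \<nu> (ball c r) < (\<integral>\<^sup>+y\<in>ball c r. g y \<partial>\<nu>)}" for R
  define S where "S R = (\<Union>(c, r)\<in>K R. ball c r)" for R
  have open_S: "open (S R)" for R by (auto simp: S_def)
  have bound: "t * emeasure \<nu> (S R) \<le> ennreal D ^ 3 * (\<integral>\<^sup>+x. g x \<partial>\<nu>)" for R
  proof -
    obtain C where C: "countable C" "C \<subseteq> K R"
       "pairwise (\<lambda>i j. disjnt (ball (fst i) (snd i)) (ball (fst j) (snd j))) C"
       "S R \<subseteq> (\<Union>i\<in>C. ball (fst i) (5 * snd i))"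
    proof (rule Vitali_covering_lemma_balls)
      show "S R \<subseteq> (\<Union>i\<in>K R. ball (fst i) (snd i))" by (simp add: S_def split_beta)
      show "0 < snd i \<and> snd i \<le> real R" if "i \<in> K R" for i using that by (simp add: K_def split_beta)
    qed
    have pos: "0 < snd i" if "i \<in> C" for i using that C(2) by (auto simp: K_def)
    have "emeasure \<nu> (S R) \<le> emeasure \<nu> (\<Union>i\<in>C. ball (fst i) (5 * snd i))"
      by (rule emeasure_mono[OF C(4)]) (auto intro!: borel_sets borel_open)
    also have "\<dots> = (\<integral>\<^sup>+x. indicator (\<Union>i\<in>C. ball (fst i) (5 * snd i)) x \<partial>\<nu>)"
      by (rule nn_integral_indicator[symmetric]) (auto intro!: borel_sets borel_open)
    also have "\<dots> \<le> (\<integral>\<^sup>+x. (\<integral>\<^sup>+i. indicator (ball (fst i) (5 * snd i)) x \<partial>count_space C) \<partial>\<nu>)"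
    proof (intro nn_integral_mono)
      fix x show "indicator (\<Union>i\<in>C. ball (fst i) (5 * snd i)) x
         \<le> (\<integral>\<^sup>+i. indicator (ball (fst i) (5 * snd i)) x \<partial>count_space C)"
      proof (cases "x \<in> (\<Union>i\<in>C. ball (fst i) (5 * snd i))")
        case True
        then obtain i where i: "i \<in> C" "x \<in> ball (fst i) (5 * snd i)" by auto
        then show ?thesis
          using nn_integral_ge_point[of i C "\<lambda>i. indicator (ball (fst i) (5 * snd i)) x :: ennreal"]
          by (simp add: indicator_def split: if_splits)
      qed simp
    qed
    also have "\<dots> = (\<integral>\<^sup>+i. (\<integral>\<^sup>+x. indicator (ball (fst i) (5 * snd i)) x \<partial>\<nu>) \<partial>count_space C)"
      by (rule nn_integral_count_space_nn_integral[OF C(1)])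
        (auto intro!: borel_measurable_indicator borel_sets)
    also have "\<dots> = (\<integral>\<^sup>+i. emeasure \<nu> (ball (fst i) (5 * snd i)) \<partial>count_space C)"
      by (intro nn_integral_cong nn_integral_indicator) (auto intro: borel_sets)
    also have "\<dots> \<le> (\<integral>\<^sup>+i. ennreal D ^ 3 * emeasure \<nu> (ball (fst i) (snd i)) \<partial>count_space C)"
      by (intro nn_integral_mono ball_dilate_5) (auto simp: pos)
    finally have "t * emeasure \<nu> (S R) \<le>
       t * (\<integral>\<^sup>+i. ennreal D ^ 3 * emeasure \<nu> (ball (fst i) (snd i)) \<partial>count_space C)"
      by (rule mult_left_mono) simp
    also have "\<dots> = ennreal D ^ 3 * (\<integral>\<^sup>+i. t * emeasure \<nu> (ball (fst i) (snd i)) \<partial>count_space C)"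
      by (simp add: nn_integral_cmult mult_ac)
    \<comment> \<open>Reading the integral of g over a ball as its mass for
      \<open>density \<nu> g\<close> makes the summation over disjoint balls plain countable
      additivity.\<close>
    also have "\<dots> \<le> ennreal D ^ 3 * (\<integral>\<^sup>+i. emeasure (density \<nu> g) (ball (fst i) (snd i)) \<partial>count_space C)"
    proof (intro mult_left_mono nn_integral_mono)
      fix i assume "i \<in> space (count_space C)"
      then have "i \<in> K R" using C by auto
      then show "t * emeasure \<nu> (ball (fst i) (snd i)) \<le> emeasure (density \<nu> g) (ball (fst i) (snd i))"
        by (auto simp: K_def emeasure_density borel_sets less_imp_le)
    qed simp
    also have "(\<integral>\<^sup>+i. emeasure (density \<nu> g) (ball (fst i) (snd i)) \<partial>count_space C) =
        emeasure (density \<nu> g) (\<Union>i\<in>C. ball (fst i) (snd i))"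
    proof (rule emeasure_UN_countable[symmetric])
      show "disjoint_family_on (\<lambda>i. ball (fst i) (snd i)) C"
        using C(3) unfolding disjoint_family_on_def pairwise_def disjnt_def by blast
    qed (use C(1) in \<open>auto intro: borel_sets\<close>)
    also have "\<dots> \<le> emeasure (density \<nu> g) (space \<nu>)"
      by (rule emeasure_mono) (auto intro: borel_sets)
    also have "\<dots> = (\<integral>\<^sup>+x. g x \<partial>\<nu>)" using sets.top[of \<nu>] by (simp add: emeasure_density del: sets.top)
    finally show ?thesis by (simp add: mult_left_mono)
  qed
  have eq: "{x. t < weighted_maximal \<nu> g x} = (\<Union>R. S R)"
  proof -
    have "\<exists>R. r \<le> real R" for r :: real by (rule real_arch_simple)
    then show ?thesis unfolding superlevel_eq S_def K_def set_eq_iff by (simp add: split_beta) blast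
  qed
  have "K m \<subseteq> K n" if "m \<le> n" for m n
    using that unfolding K_def by (auto intro: order.trans)
  then have "incseq S" by (auto simp: incseq_def S_def)
  then have "emeasure \<nu> (\<Union>R. S R) = (SUP R. emeasure \<nu> (S R))"
    by (intro SUP_emeasure_incseq[symmetric]) (use borel_sets[OF borel_open[OF open_S]] in auto)
  then show ?thesis unfolding eq by (auto simp: SUP_mult_left_ennreal bound intro!: SUP_least)
qed

text \<open>The part of g with values at most t/2 contributes at most t/2 to any average, so an
  average above t leaves more than t/2 for the truncated part. This replaces the trivial bound at
  the endpoint \<infinity> in the interpolation.\<close>

lemma weighted_maximal_superlevel_truncate:
  assumes [measurable]: "g \<in> borel_measurable \<nu>"
  shows "{x. ennreal t < weighted_maximal \<nu> g x} \<subseteq>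
    {x. ennreal (t / 2) < weighted_maximal \<nu> (\<lambda>x. g x * indicator {x. ennreal t < 2 * g x} x) x}"
proof (cases "0 < t")
  case True
  let ?h = "\<lambda>x. g x * indicator {x. ennreal t < 2 * g x} x"
  have "ennreal (t / 2) * emeasure \<nu> (ball c r) < (\<integral>\<^sup>+y\<in>ball c r. ?h y \<partial>\<nu>)"
    if r: "0 < r" and *: "ennreal t * emeasure \<nu> (ball c r) < (\<integral>\<^sup>+y\<in>ball c r. g y \<partial>\<nu>)" for c r
  proof (rule ccontr)
    assume "\<not> ?thesis"
    then have le: "(\<integral>\<^sup>+y\<in>ball c r. ?h y \<partial>\<nu>) \<le> ennreal (t / 2) * emeasure \<nu> (ball c r)" by simp
    have [measurable]: "ball c r \<in> sets \<nu>" by (simp add: borel_sets)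
    have "g y \<le> ennreal (t/2) + ?h y" for y
    proof (cases "ennreal t < 2 * g y")
      case False
      then have "2 * g y \<le> 2 * ennreal (t/2)"
        by (simp add: not_less ennreal_mult'[symmetric] ennreal_numeral[symmetric] del: ennreal_numeral)
      then show ?thesis by (simp add: indicator_def False ennreal_mult_le_mult_iff)
    qed simp
    then have "(\<integral>\<^sup>+y\<in>ball c r. g y \<partial>\<nu>) \<le> (\<integral>\<^sup>+y. ennreal (t/2) * indicator (ball c r) y + ?h y * indicator (ball c r) y \<partial>\<nu>)"
      by (intro nn_integral_mono) (auto simp: indicator_def)
    also have "\<dots> = ennreal (t/2) * emeasure \<nu> (ball c r) + (\<integral>\<^sup>+y\<in>ball c r. ?h y \<partial>\<nu>)"
      by (subst nn_integral_add) (auto simp: nn_integral_cmult_indicator)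
    also have "\<dots> \<le> ennreal (t/2) * emeasure \<nu> (ball c r) + ennreal (t/2) * emeasure \<nu> (ball c r)"
      by (intro add_left_mono le)
    also have "\<dots> = ennreal t * emeasure \<nu> (ball c r)"
      using True by (simp add: distrib_right[symmetric] ennreal_plus[symmetric] del: ennreal_plus)
    finally show False using * by simp
  qed
  then show ?thesis unfolding superlevel_eq by (intro UN_mono) auto
next
  case False
  \<comment> \<open>For t \<le> 0 both levels are coerced to 0, and the truncation removes only
    points where g is already 0.\<close>
  then have t: "ennreal t = 0" "ennreal (t/2) = 0" by (auto simp: ennreal_eq_0_iff)
  have "(\<lambda>x. g x * indicator {x. ennreal t < 2 * g x} x) = g"
    by (auto simp: fun_eq_iff t indicator_def zero_less_iff_neq_zero)
  then show ?thesis by (simp add: t)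
qed

text \<open>Marcinkiewicz interpolation: the weak type bound is applied at each level t to the part
  of g above t/2, and integrated against a t^(a-1) dt.\<close>

lemma strong_type:
  assumes a: "1 < a"
  shows "\<exists>K>0. \<forall>g\<in>borel_measurable \<nu>.
    (\<integral>\<^sup>+x. epowr (weighted_maximal \<nu> g x) a \<partial>\<nu>) \<le> ennreal K * (\<integral>\<^sup>+x. epowr (g x) a \<partial>\<nu>)"
proof -
  define D' where "D' = max 1 D"
  \<comment> \<open>The factor 2 \<open>D'\<close>^3 is the weak type constant at level t/2, a/(a-1)
    comes from integrating a t^(a-2), and 2^(a-1) from the upper limit 2 g(x). Replacing
    \<open>D\<close> by \<open>D'\<close> keeps the constant positive.\<close>
  define K where "K = 2 * a / (a - 1) * D' ^ 3 * 2 powr (a - 1)"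
  have K: "K > 0" using a by (simp add: K_def D'_def)
  have "(\<integral>\<^sup>+x. epowr (weighted_maximal \<nu> g x) a \<partial>\<nu>) \<le> ennreal K * (\<integral>\<^sup>+x. epowr (g x) a \<partial>\<nu>)"
    if [measurable]: "g \<in> borel_measurable \<nu>" for g
  proof -
    interpret sigma_finite_measure \<nu> by (rule sigma_finite)
    interpret P: pair_sigma_finite lborel \<nu> ..
    have D': "ennreal D ^ 3 \<le> ennreal (D' ^ 3)"
      by (simp add: D'_def ennreal_power[symmetric] power_mono ennreal_leI)
    define H where "H t x = ennreal (t powr (a - 2)) * indicator {t. 0 < t \<and> ennreal t < 2 * g x} t" for t x
    have H [measurable]: "(\<lambda>(t, x). H t x) \<in> borel_measurable (lborel \<Otimes>\<^sub>M \<nu>)"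
      unfolding H_def by measurable
    have weak: "ennreal t * emeasure \<nu> {x. ennreal t < weighted_maximal \<nu> g x}
       \<le> ennreal (2 * D' ^ 3) * (\<integral>\<^sup>+x. g x * indicator {x. ennreal t < 2 * g x} x \<partial>\<nu>)" if "0 < t" for t
    proof -
      let ?h = "\<lambda>x. g x * indicator {x. ennreal t < 2 * g x} x"
      have "emeasure \<nu> {x. ennreal t < weighted_maximal \<nu> g x} \<le> emeasure \<nu> {x. ennreal (t/2) < weighted_maximal \<nu> ?h x}"
        by (intro emeasure_mono weighted_maximal_superlevel_truncate superlevel_sets) auto
      then have "ennreal t * emeasure \<nu> {x. ennreal t < weighted_maximal \<nu> g x} \<le>
         2 * (ennreal (t/2) * emeasure \<nu> {x. ennreal (t/2) < weighted_maximal \<nu> ?h x})"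
        using that by (subst mult.assoc[symmetric])
          (simp add: ennreal_numeral[symmetric] ennreal_mult[symmetric] mult_left_mono del: ennreal_numeral)
      also have "\<dots> \<le> 2 * (ennreal D ^ 3 * (\<integral>\<^sup>+x. ?h x \<partial>\<nu>))"
        by (intro mult_left_mono weak_type) auto
      also have "\<dots> \<le> 2 * (ennreal (D' ^ 3) * (\<integral>\<^sup>+x. ?h x \<partial>\<nu>))"
        by (intro mult_left_mono mult_right_mono D') auto
      also have "\<dots> = ennreal (2 * D' ^ 3) * (\<integral>\<^sup>+x. ?h x \<partial>\<nu>)"
        by (simp add: ennreal_mult'' D'_def mult.assoc)
      finally show ?thesis .
    qed
    have "(\<integral>\<^sup>+x. epowr (weighted_maximal \<nu> g x) a \<partial>\<nu>) =
      (\<integral>\<^sup>+x. (\<integral>\<^sup>+t. ennreal (a * t powr (a - 1)) * indicator {t. 0 < t \<and> ennreal t < weighted_maximal \<nu> g x} t \<partial>lborel) \<partial>\<nu>)"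
      using a by (simp add: epowr_layer_cake)
    also have "\<dots> = (\<integral>\<^sup>+t. (\<integral>\<^sup>+x. ennreal (a * t powr (a - 1)) * indicator {t. 0 < t \<and> ennreal t < weighted_maximal \<nu> g x} t \<partial>\<nu>) \<partial>lborel)"
      by (rule P.Fubini') measurable
    also have "\<dots> \<le> (\<integral>\<^sup>+t. (\<integral>\<^sup>+x. ennreal (2 * a * D' ^ 3) * (g x * H t x) \<partial>\<nu>) \<partial>lborel)"
    proof (rule nn_integral_mono)
      fix t :: real
      show "(\<integral>\<^sup>+x. ennreal (a * t powr (a - 1)) * indicator {t. 0 < t \<and> ennreal t < weighted_maximal \<nu> g x} t \<partial>\<nu>)
        \<le> (\<integral>\<^sup>+x. ennreal (2 * a * D' ^ 3) * (g x * H t x) \<partial>\<nu>)"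
      proof (cases "0 < t")
        case True
        have "(\<integral>\<^sup>+x. ennreal (a * t powr (a - 1)) * indicator {t. 0 < t \<and> ennreal t < weighted_maximal \<nu> g x} t \<partial>\<nu>)
          = (\<integral>\<^sup>+x. ennreal (a * t powr (a - 1)) * indicator {x. ennreal t < weighted_maximal \<nu> g x} x \<partial>\<nu>)"
          using True by (intro nn_integral_cong) (simp add: indicator_def)
        also have "\<dots> = ennreal (a * t powr (a - 1)) * emeasure \<nu> {x. ennreal t < weighted_maximal \<nu> g x}"
          by (intro nn_integral_cmult_indicator superlevel_sets)
        also have "\<dots> = ennreal (a * t powr (a - 2)) * (ennreal t * emeasure \<nu> {x. ennreal t < weighted_maximal \<nu> g x})"
        proof -
          have "a * t powr (a - 1) = a * t powr (a - 2) * t"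
            using True powr_add[of t "a - 2" 1] by simp
          then show ?thesis using True a by (simp add: ennreal_mult mult.assoc)
        qed
        also have "\<dots> \<le> ennreal (a * t powr (a - 2)) * (ennreal (2 * D' ^ 3) *
             (\<integral>\<^sup>+x. g x * indicator {x. ennreal t < 2 * g x} x \<partial>\<nu>))"
          by (intro mult_left_mono weak True) simp
        also have "\<dots> = (\<integral>\<^sup>+x. ennreal (a * t powr (a - 2)) * (ennreal (2 * D' ^ 3) *
             (g x * indicator {x. ennreal t < 2 * g x} x)) \<partial>\<nu>)"
          by (simp add: nn_integral_cmult)
        also have "\<dots> = (\<integral>\<^sup>+x. ennreal (2 * a * D' ^ 3) * (g x * H t x) \<partial>\<nu>)"
          using True a by (intro nn_integral_cong)
            (auto simp: H_def indicator_def ennreal_mult D'_def mult_ac)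
        finally show ?thesis .
      qed simp
    qed
    also have "\<dots> = (\<integral>\<^sup>+x. (\<integral>\<^sup>+t. ennreal (2 * a * D' ^ 3) * (g x * H t x) \<partial>lborel) \<partial>\<nu>)"
      by (rule P.Fubini'[symmetric]) measurable
    also have "\<dots> = (\<integral>\<^sup>+x. ennreal K * epowr (g x) a \<partial>\<nu>)"
    proof (intro nn_integral_cong)
      fix x
      \<comment> \<open>For fixed x this is the layer cake formula with exponent a - 1 read
        backwards; integrability near t = 0 is where a > 1 enters.\<close>
      have "(\<integral>\<^sup>+t. ennreal (2 * a * D' ^ 3) * (g x * H t x) \<partial>lborel) =
         (\<integral>\<^sup>+t. ennreal (2 * a / (a - 1) * D' ^ 3) * (g x * (ennreal ((a - 1) * t powr ((a - 1) - 1)) *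
             indicator {t. 0 < t \<and> ennreal t < 2 * g x} t)) \<partial>lborel)"
      proof (intro nn_integral_cong)
        fix t
        have "2 * a * D' ^ 3 = (2 * a / (a - 1) * D' ^ 3) * (a - 1)" using a by simp
        then have "ennreal (2 * a * D' ^ 3) = ennreal (2 * a / (a - 1) * D' ^ 3) * ennreal (a - 1)"
          using a by (simp only: ennreal_mult'')
        then show "ennreal (2 * a * D' ^ 3) * (g x * H t x) = ennreal (2 * a / (a - 1) * D' ^ 3) *
           (g x * (ennreal ((a - 1) * t powr ((a - 1) - 1)) * indicator {t. 0 < t \<and> ennreal t < 2 * g x} t))"
          using a by (simp add: H_def ennreal_mult mult_ac)
      qed
      also have "\<dots> = ennreal (2 * a / (a - 1) * D' ^ 3) * (g x * epowr (2 * g x) (a - 1))"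
        using a by (simp add: nn_integral_cmult epowr_layer_cake)
      also have "\<dots> = ennreal (2 * a / (a - 1) * D' ^ 3) * (ennreal (2 powr (a-1)) * (epowr (g x) 1 * epowr (g x) (a - 1)))"
        using a epowr_ennreal_pos[of 2 "a-1"] by (simp add: epowr_mult mult_ac)
      also have "epowr (g x) 1 * epowr (g x) (a - 1) = epowr (g x) a"
        using a by (subst epowr_add[symmetric]) auto
      finally show "(\<integral>\<^sup>+t. ennreal (2 * a * D' ^ 3) * (g x * H t x) \<partial>lborel) = ennreal K * epowr (g x) a"
        unfolding K_def by (simp only: ennreal_mult''[OF powr_ge_zero]) (simp only: mult.assoc)
    qed
    also have "\<dots> = ennreal K * (\<integral>\<^sup>+x. epowr (g x) a \<partial>\<nu>)"
      by (rule nn_integral_cmult) measurable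
    finally show ?thesis .
  qed
  with K show ?thesis by blast
qed

end

subsection \<open>Doubling of the weights\<close>

lemma measure_lebesgue_ball_pos:
  fixes c :: "real ^ 'n"
  assumes "0 < r"
  shows "0 < measure lebesgue (ball c r)"
  using assms by (simp add: measure_def emeasure_ball)

lemma measure_lebesgue_ball_mult:
  fixes c c' :: "real ^ 'n"
  assumes "0 \<le> r" "0 \<le> t"
  shows "measure lebesgue (ball c (t * r)) = t ^ CARD('n) * measure lebesgue (ball c' r)"
  using assms by (simp add: measure_def emeasure_ball power_mult_distrib)

lemma emeasure_lebesgue_ball_eq:
  fixes c :: "real ^ 'n"
  assumes "0 < r"
  shows "emeasure lebesgue (ball c r) = ennreal (measure lebesgue (ball c r))"
  using assms by (simp add: measure_def emeasure_ball)

lemma sets_weight_measure [simp, measurable_cong]: "sets (weight_measure w) = sets lebesgue"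
  by (simp add: weight_measure_def)

lemma space_weight_measure [simp]: "space (weight_measure w) = UNIV"
  by (simp add: weight_measure_def)

lemma nn_integral_weight_measure:
  assumes "w \<in> borel_measurable lebesgue" "g \<in> borel_measurable lebesgue"
  shows "(\<integral>\<^sup>+x. g x \<partial>weight_measure w) = (\<integral>\<^sup>+x. ennreal (w x) * g x \<partial>lebesgue)"
  unfolding weight_measure_def using assms by (subst nn_integral_density) auto

lemma emeasure_weight_measure:
  assumes "w \<in> borel_measurable lebesgue" "A \<in> sets lebesgue"
  shows "emeasure (weight_measure w) A = (\<integral>\<^sup>+x\<in>A. ennreal (w x) \<partial>lebesgue)"
  unfolding weight_measure_def using assms by (subst emeasure_density) auto

lemma powr_le_imp_le:
  fixes a b k t :: real
  assumes "a powr t \<le> k * b powr t" "0 < t" "0 \<le> a" "0 \<le> b" "0 \<le> k"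
  shows "a \<le> k powr (1 / t) * b"
proof -
  have "(a powr t) powr (1 / t) \<le> (k * b powr t) powr (1 / t)"
    by (intro powr_mono2) (use assms in auto)
  then show ?thesis using assms by (simp add: powr_mult powr_powr)
qed

text \<open>The nondegenerate form of the class condition. The two normalising volumes, with total
  exponent 1/q + 1/p' = 1 - \<gamma>/n, are moved to the right; this is the exponent in the
  fractional maximal operator.\<close>

locale Apq_weight =
  fixes w :: "real ^ 'n \<Rightarrow> real" and \<gamma> p q p' C :: real
  assumes gamma: "0 < \<gamma>" "\<gamma> < real CARD('n)"
    and p: "1 < p" "p < real CARD('n) / \<gamma>"
    and q_eq: "1 / q = 1 / p - \<gamma> / real CARD('n)"
    and p'_def: "p' = p / (p - 1)"
    and w_measurable [measurable]: "w \<in> borel_measurable lebesgue"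
    and w_pos: "AE x in lebesgue. 0 < w x"
    and U_fin: "0 < r \<Longrightarrow> emeasure (weight_measure (\<lambda>x. w x powr q)) (ball c r) \<noteq> \<infinity>"
    and V_fin: "0 < r \<Longrightarrow> emeasure (weight_measure (\<lambda>x. w x powr (- p'))) (ball c r) \<noteq> \<infinity>"
    and C: "0 < C"
    and Apq: "0 < r \<Longrightarrow>
      measure (weight_measure (\<lambda>x. w x powr q)) (ball c r) powr (1 / q) *
      measure (weight_measure (\<lambda>x. w x powr (- p'))) (ball c r) powr (1 / p')
      \<le> C * measure lebesgue (ball c r) powr (1 - \<gamma> / real CARD('n))"
begin

abbreviation "U \<equiv> weight_measure (\<lambda>x. w x powr q)"
abbreviation "V \<equiv> weight_measure (\<lambda>x. w x powr (- p'))"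
abbreviation "W \<equiv> weight_measure (\<lambda>x. w x powr p)"
text \<open>The exponent with q \<theta> = p' (1 - \<theta>), for which the product of w^q to the
  power \<theta> and w^(-p') to the power 1 - \<theta> is 1.\<close>

definition "\<theta> = p' / (q + p')"

lemma p'_gt_1: "1 < p'" and p'_eq: "1 / p' = 1 - 1 / p"
  using p by (auto simp: p'_def field_simps)

lemma q_pos: "0 < q" and q_gt_p: "p < q"
proof -
  have "\<gamma> / real CARD('n) < 1 / p" using p gamma by (simp add: field_simps)
  then have "0 < 1 / q" using q_eq by simp
  then show q: "0 < q" by simp
  have "1 / q < 1 / p" using q_eq gamma by simp
  then show "p < q" using q p by (simp add: field_simps)
qed

lemma theta: "0 < \<theta>" "\<theta> < 1" "1 - \<theta> = q / (q + p')"
  using q_pos p'_gt_1 by (auto simp: \<theta>_def field_simps)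

lemma gamma_eq: "1 - \<gamma> / real CARD('n) = 1 / q + 1 / p'"
  using q_eq p'_eq by simp

text \<open>Hoelder applied to 1 = (w^q)^\<theta> (w^(-p'))^(1-\<theta>) on
  \<open>E\<close>.\<close>

lemma Holder_set:
  assumes [measurable]: "E \<in> sets lebesgue"
  shows "emeasure lebesgue E \<le> epowr (emeasure U E) \<theta> * epowr (emeasure V E) (1 - \<theta>)"
proof -
  have "emeasure lebesgue E = (\<integral>\<^sup>+x. indicator E x \<partial>lebesgue)" by simp
  also have "\<dots> = (\<integral>\<^sup>+x. epowr (ennreal (w x powr q) * indicator E x) \<theta> *
     epowr (ennreal (w x powr (- p')) * indicator E x) (1 - \<theta>) \<partial>lebesgue)"
  proof (rule nn_integral_cong_AE, use w_pos in eventually_elim)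
    fix x assume x: "0 < w x"
    have "q * \<theta> + (- p') * (1 - \<theta>) = 0" using theta(3) by (simp add: \<theta>_def)
    then have "(w x powr q) powr \<theta> * (w x powr (- p')) powr (1 - \<theta>) = 1"
      using x by (simp add: powr_powr powr_add[symmetric] del: powr_minus)
    then show "indicator E x = epowr (ennreal (w x powr q) * indicator E x) \<theta> *
     epowr (ennreal (w x powr (- p')) * indicator E x) (1 - \<theta>)"
      using x theta by (cases "x \<in> E") (simp_all add: epowr_ennreal_pos ennreal_mult[symmetric])
  qed
  also have "\<dots> \<le> epowr (\<integral>\<^sup>+x. ennreal (w x powr q) * indicator E x \<partial>lebesgue) \<theta> *
     epowr (\<integral>\<^sup>+x. ennreal (w x powr (- p')) * indicator E x \<partial>lebesgue) (1 - \<theta>)"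
    by (rule Holder_nn_integral) (use theta in auto)
  also have "\<dots> = epowr (emeasure U E) \<theta> * epowr (emeasure V E) (1 - \<theta>)"
    by (simp add: emeasure_weight_measure)
  finally show ?thesis .
qed

lemma U_ball_pos: assumes "0 < r" shows "emeasure U (ball c r) \<noteq> 0"
proof
  assume "emeasure U (ball c r) = 0"
  then have "emeasure lebesgue (ball c r) = 0"
    using Holder_set[of "ball c r"] theta by simp
  then show False using measure_lebesgue_ball_pos[OF assms, of c] by (simp add: measure_def)
qed

lemma V_ball_pos: assumes "0 < r" shows "emeasure V (ball c r) \<noteq> 0"
proof
  assume "emeasure V (ball c r) = 0"
  then have "emeasure lebesgue (ball c r) = 0"
    using Holder_set[of "ball c r"] theta by simp
  then show False using measure_lebesgue_ball_pos[OF assms, of c] by (simp add: measure_def)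
qed

lemma U_eq: "0 < r \<Longrightarrow> emeasure U (ball c r) = ennreal (measure U (ball c r))"
  and V_eq: "0 < r \<Longrightarrow> emeasure V (ball c r) = ennreal (measure V (ball c r))"
  using U_fin V_fin by (auto simp: emeasure_eq_ennreal_measure infinity_ennreal_def)

lemma U_pos: "0 < r \<Longrightarrow> 0 < measure U (ball c r)"
  and V_pos: "0 < r \<Longrightarrow> 0 < measure V (ball c r)"
  using U_ball_pos[of r c] V_ball_pos[of r c] U_eq[of r c] V_eq[of r c]
  by (auto simp: less_le)

definition "C' = C powr (q * p' / (q + p'))"

lemma C'_pos: "0 < C'" using C by (simp add: C'_def)

text \<open>Raising the class condition to the reciprocal of 1/q + 1/p' makes the Lebesgue exponent
  1 and the other two \<theta> and 1 - \<theta>, matching \<open>Holder_set\<close>. This is also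
  the origin of \<open>C'\<close>.\<close>

lemma Apq_theta:
  assumes "0 < r"
  shows "measure U (ball c r) powr \<theta> * measure V (ball c r) powr (1 - \<theta>)
    \<le> C' * measure lebesgue (ball c r)"
proof -
  let ?k = "q * p' / (q + p')"
  have k: "0 < ?k" using q_pos p'_gt_1 by simp
  have e: "1 / q * ?k = \<theta>" "1 / p' * ?k = 1 - \<theta>" "(1 - \<gamma> / real CARD('n)) * ?k = 1"
  proof -
    show "1 / q * ?k = \<theta>" "1 / p' * ?k = 1 - \<theta>"
      unfolding theta(3) using q_pos p'_gt_1 by (auto simp: \<theta>_def)
    have "1 / q + 1 / p' = (q + p') / (q * p')" using q_pos p'_gt_1 by (simp add: field_simps)
    then show "(1 - \<gamma> / real CARD('n)) * ?k = 1" unfolding gamma_eq using q_pos p'_gt_1 by simp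
  qed
  have "(measure U (ball c r) powr (1 / q) * measure V (ball c r) powr (1 / p')) powr ?k
     \<le> (C * measure lebesgue (ball c r) powr (1 - \<gamma> / real CARD('n))) powr ?k"
    by (intro powr_mono2 Apq assms) (use k in auto)
  then show ?thesis
    using C measure_lebesgue_ball_pos[OF assms, of c]
    by (simp only: powr_mult powr_powr e C'_def) simp
qed

text \<open>Both weights are \<open>A\<^sub>\<infinity>\<close>: the two-weight condition at exponents \<open>\<theta>\<close> and \<open>1 - \<theta>\<close> reverses the
  Hoelder inequality \<open>Holder_set\<close> up to \<open>C'\<close>, which gives doubling and reverse doubling.\<close>

lemma Apq_subset:
  assumes r: "0 < r" and E: "E \<in> sets lebesgue" "E \<subseteq> ball c r"
  shows "measure lebesgue E * measure U (ball c r) powr \<theta>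
      \<le> C' * measure lebesgue (ball c r) * measure U E powr \<theta>"
    and "measure lebesgue E * measure V (ball c r) powr (1 - \<theta>)
      \<le> C' * measure lebesgue (ball c r) * measure V E powr (1 - \<theta>)"
proof -
  have fin: "emeasure M E = ennreal (measure M E)" "measure M E \<le> measure M (ball c r)"
    if "emeasure M (ball c r) \<noteq> \<infinity>" "sets M = sets lebesgue" for M :: "(real ^ 'n) measure"
  proof -
    have le: "emeasure M E \<le> emeasure M (ball c r)"
      by (intro emeasure_mono E) (simp add: that)
    then show "emeasure M E = ennreal (measure M E)"
      using that by (metis emeasure_eq_ennreal_measure infinity_ennreal_def neq_top_trans)
    show "measure M E \<le> measure M (ball c r)"
      unfolding measure_def using le that
      by (intro enn2real_mono) (auto simp: less_top infinity_ennreal_def)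
  qed
  have L: "emeasure lebesgue E = ennreal (measure lebesgue E)"
    by (rule fin(1)) (use r in \<open>auto simp: emeasure_ball\<close>)
  note u = fin[OF U_fin[OF r, of c], simplified] and v = fin[OF V_fin[OF r, of c], simplified]
  have "ennreal (measure lebesgue E) \<le> ennreal (measure U E powr \<theta> * measure V E powr (1 - \<theta>))"
    using Holder_set[OF E(1)] theta unfolding L u(1) v(1) by (simp add: epowr_ennreal ennreal_mult)
  then have H: "measure lebesgue E \<le> measure U E powr \<theta> * measure V E powr (1 - \<theta>)"
    by (simp add: ennreal_le_iff)
  let ?a = "measure U (ball c r) powr \<theta>" and ?b = "measure V (ball c r) powr (1 - \<theta>)"
  have "measure U E powr \<theta> \<le> ?a" "measure V E powr (1 - \<theta>) \<le> ?b"
    using u(2) v(2) theta by (auto intro: powr_mono2)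
  \<comment> \<open>Only one factor at a time is enlarged from \<open>E\<close> to the ball: the
    enlarged one is absorbed by \<open>Apq_theta\<close>, the other keeps the mass of
    \<open>E\<close>.\<close>
  then have H': "measure lebesgue E \<le> measure U E powr \<theta> * ?b"
     "measure lebesgue E \<le> ?a * measure V E powr (1 - \<theta>)"
    by (auto intro!: order.trans[OF H] mult_left_mono mult_right_mono)
  have "measure lebesgue E * ?a \<le> measure U E powr \<theta> * ?b * ?a"
    by (intro mult_right_mono H') auto
  also have "\<dots> \<le> measure U E powr \<theta> * (C' * measure lebesgue (ball c r))"
    using mult_left_mono[OF Apq_theta[OF r, of c], of "measure U E powr \<theta>"] by (simp add: mult_ac)
  finally show "measure lebesgue E * ?a \<le> C' * measure lebesgue (ball c r) * measure U E powr \<theta>"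
    by (simp add: mult_ac)
  have "measure lebesgue E * ?b \<le> ?a * measure V E powr (1 - \<theta>) * ?b"
    by (intro mult_right_mono H') auto
  also have "\<dots> \<le> measure V E powr (1 - \<theta>) * (C' * measure lebesgue (ball c r))"
    using mult_left_mono[OF Apq_theta[OF r, of c], of "measure V E powr (1 - \<theta>)"] by (simp add: mult_ac)
  finally show "measure lebesgue E * ?b \<le> C' * measure lebesgue (ball c r) * measure V E powr (1 - \<theta>)"
    by (simp add: mult_ac)
qed

definition "DU = (C' * 2 ^ CARD('n)) powr (1 / \<theta>)"
definition "DV = (C' * 2 ^ CARD('n)) powr (1 / (1 - \<theta>))"

text \<open>\<open>Apq_subset\<close> is used with \<open>E\<close> the ball of radius r inside the
  ball of radius 2r. The volume ratio 2^n and the removal of the powers \<theta> and 1 - \<theta>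
  give \<open>DU\<close> and \<open>DV\<close>.\<close>

lemma U_doubling: "0 < r \<Longrightarrow> measure U (ball c (2 * r)) \<le> DU * measure U (ball c r)"
  and V_doubling: "0 < r \<Longrightarrow> measure V (ball c (2 * r)) \<le> DV * measure V (ball c r)"
proof -
  assume r: "0 < r"
  have sub: "ball c r \<subseteq> ball c (2 * r)" using r by auto
  have m: "measure lebesgue (ball c (2 * r)) = 2 ^ CARD('n) * measure lebesgue (ball c r)"
    using r by (intro measure_lebesgue_ball_mult) auto
  have pos: "0 < measure lebesgue (ball c r)" by (rule measure_lebesgue_ball_pos[OF r])
  have "measure lebesgue (ball c r) * measure U (ball c (2 * r)) powr \<theta> \<le>
     measure lebesgue (ball c r) * (C' * 2 ^ CARD('n) * measure U (ball c r) powr \<theta>)"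
    using Apq_subset(1)[OF _ _ sub, unfolded m] r by (simp add: mult_ac)
  then have "measure U (ball c (2 * r)) powr \<theta> \<le> C' * 2 ^ CARD('n) * measure U (ball c r) powr \<theta>"
    using pos by (simp only: mult_le_cancel_left_pos)
  then show "measure U (ball c (2 * r)) \<le> DU * measure U (ball c r)"
    unfolding DU_def using theta C'_pos by (intro powr_le_imp_le) auto
  have "measure lebesgue (ball c r) * measure V (ball c (2 * r)) powr (1 - \<theta>) \<le>
     measure lebesgue (ball c r) * (C' * 2 ^ CARD('n) * measure V (ball c r) powr (1 - \<theta>))"
    using Apq_subset(2)[OF _ _ sub, unfolded m] r by (simp add: mult_ac)
  then have "measure V (ball c (2 * r)) powr (1 - \<theta>) \<le> C' * 2 ^ CARD('n) * measure V (ball c r) powr (1 - \<theta>)"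
    using pos by (simp only: mult_le_cancel_left_pos)
  then show "measure V (ball c (2 * r)) \<le> DV * measure V (ball c r)"
    unfolding DV_def using theta C'_pos by (intro powr_le_imp_le) auto
qed

sublocale U: doubling_measure U DU
proof
  show "emeasure U (ball c (2 * r)) \<le> ennreal DU * emeasure U (ball c r)" if "0 < r" for c r
    using that U_doubling[OF that, of c]
    by (simp add: U_eq ennreal_mult'[symmetric] DU_def ennreal_leI)
qed (use U_ball_pos U_fin in auto)

sublocale V: doubling_measure V DV
proof
  show "emeasure V (ball c (2 * r)) \<le> ennreal DV * emeasure V (ball c r)" if "0 < r" for c r
    using that V_doubling[OF that, of c]
    by (simp add: V_eq ennreal_mult'[symmetric] DV_def ennreal_leI)
qed (use V_ball_pos V_fin in auto)

text \<open>The annulus between the two balls has at least half the volume of the larger one, so by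
  \<open>Apq_subset\<close> it carries a fixed fraction \<kappa> of the \<open>U\<close>-mass, which
  the smaller ball must miss.\<close>

lemma U_reverse_doubling:
  "\<exists>\<delta>. 0 < \<delta> \<and> \<delta> < 1 \<and> (\<forall>c r. 0 < r \<longrightarrow> measure U (ball c r) \<le> \<delta> * measure U (ball c (2 * r)))"
proof -
  define \<kappa> where "\<kappa> = 1 / (2 * C') powr (1 / \<theta>)"
  have \<kappa>: "0 < \<kappa>" using C'_pos by (simp add: \<kappa>_def)
  have *: "measure U (ball c r) \<le> (1 - \<kappa>) * measure U (ball c (2 * r))" if r: "0 < r" for c r
  proof -
    let ?E = "ball c (2 * r) - ball c r"
    have sub: "ball c r \<subseteq> ball c (2 * r)" using r by auto
    have mE: "measure M ?E = measure M (ball c (2 * r)) - measure M (ball c r)"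
      if "emeasure M (ball c (2 * r)) \<noteq> \<infinity>" "sets M = sets lebesgue" for M :: "(real ^ 'n) measure"
      using that sub by (intro measure_Diff) (auto simp: infinity_ennreal_def)
    have "measure lebesgue (ball c (2 * r)) = 2 ^ CARD('n) * measure lebesgue (ball c r)"
      using r by (intro measure_lebesgue_ball_mult) auto
    moreover have "(2::real) ^ 1 \<le> 2 ^ CARD('n)" by (intro power_increasing) (auto simp: Suc_leI)
    ultimately have "2 * measure lebesgue (ball c r) \<le> measure lebesgue (ball c (2 * r))"
      by (simp add: mult_right_mono)
    then have half: "measure lebesgue (ball c (2 * r)) \<le> 2 * measure lebesgue ?E"
      using r by (subst mE) (auto simp: emeasure_ball)
    have pos: "0 < measure lebesgue (ball c (2 * r))" using r by (intro measure_lebesgue_ball_pos) simp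
    have "measure lebesgue (ball c (2 * r)) * measure U (ball c (2 * r)) powr \<theta> \<le>
       2 * measure lebesgue ?E * measure U (ball c (2 * r)) powr \<theta>"
      by (intro mult_right_mono half) simp
    also have "\<dots> \<le> measure lebesgue (ball c (2 * r)) * (2 * C' * measure U ?E powr \<theta>)"
      using Apq_subset(1)[of "2 * r" ?E c] r by (simp add: mult_ac)
    finally have "measure U (ball c (2 * r)) powr \<theta> \<le> 2 * C' * measure U ?E powr \<theta>"
      using pos by (simp only: mult_le_cancel_left_pos)
    then have "measure U (ball c (2 * r)) \<le> (2 * C') powr (1 / \<theta>) * measure U ?E"
      using theta C'_pos by (intro powr_le_imp_le) auto
    then have "\<kappa> * measure U (ball c (2 * r)) \<le> measure U ?E"
      using C'_pos by (simp add: \<kappa>_def field_simps)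
    moreover have "measure U ?E = measure U (ball c (2 * r)) - measure U (ball c r)"
      using r U_fin[of "2 * r" c] by (intro mE) auto
    ultimately show ?thesis by (simp add: algebra_simps)
  qed
  \<comment> \<open>A single instance of the inequality, with both masses positive, forces 1 -
    \<kappa> > 0.\<close>
  have "0 < measure U (ball 0 1)" "0 < measure U (ball 0 (2 * 1))" by (auto intro: U_pos)
  then have "0 < 1 - \<kappa>" using *[of 1 0] by (smt (verit) mult_nonpos_nonneg)
  with * \<kappa> show ?thesis by (intro exI[of _ "1 - \<kappa>"]) auto
qed

text \<open>The pairing of |f| w, in the p-norm, with 1/w, in the p'-norm.\<close>

lemma Holder_ball:
  assumes [measurable]: "f \<in> borel_measurable lebesgue" "B \<in> sets lebesgue"
  shows "(\<integral>\<^sup>+y\<in>B. ennreal \<bar>f y\<bar> \<partial>lebesgue) \<le>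
     epowr (\<integral>\<^sup>+y\<in>B. ennreal (\<bar>f y\<bar> powr p) \<partial>W) (1 / p) * epowr (emeasure V B) (1 / p')"
proof -
  have "(\<integral>\<^sup>+y\<in>B. ennreal \<bar>f y\<bar> \<partial>lebesgue) =
     (\<integral>\<^sup>+y. epowr (ennreal (w y powr p) * (ennreal (\<bar>f y\<bar> powr p) * indicator B y)) (1 / p) *
       epowr (ennreal (w y powr (- p')) * indicator B y) (1 - 1 / p) \<partial>lebesgue)"
  proof (rule nn_integral_cong_AE, use w_pos in eventually_elim)
    fix x assume x: "0 < w x"
    have "- p' * (1 - 1 / p) = - 1" using p'_eq p'_gt_1 by (simp add: p'_eq[symmetric])
    then have "(w x powr (- p')) powr (1 - 1/p) = 1 / w x"
      using x by (simp only: powr_powr) (simp add: powr_minus_divide)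
    then have "(w x powr p * \<bar>f x\<bar> powr p) powr (1/p) * (w x powr (- p')) powr (1 - 1/p) = \<bar>f x\<bar>"
      using x p by (simp add: powr_powr powr_mult)
    then show "ennreal \<bar>f x\<bar> * indicator B x =
       epowr (ennreal (w x powr p) * (ennreal (\<bar>f x\<bar> powr p) * indicator B x)) (1 / p) *
       epowr (ennreal (w x powr (- p')) * indicator B x) (1 - 1 / p)"
      using x p by (cases "x \<in> B") (simp_all add: epowr_ennreal ennreal_mult[symmetric])
  qed
  also have "\<dots> \<le> epowr (\<integral>\<^sup>+y. ennreal (w y powr p) * (ennreal (\<bar>f y\<bar> powr p) * indicator B y) \<partial>lebesgue) (1 / p)
     * epowr (\<integral>\<^sup>+y. ennreal (w y powr (- p')) * indicator B y \<partial>lebesgue) (1 - 1 / p)"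
    by (rule Holder_nn_integral) (use p in auto)
  finally show ?thesis
    by (simp add: nn_integral_weight_measure emeasure_weight_measure p'_eq)
qed

end

subsection \<open>Strong type inequality for the fractional maximal operator\<close>

lemma frac_maximal_borel: "frac_maximal \<gamma> f \<in> borel_measurable borel"
  unfolding frac_maximal_def[abs_def] by (rule ball_sup_measurable)

lemma frac_maximal_measurable [measurable]: "frac_maximal \<gamma> f \<in> borel_measurable lebesgue"
  by (intro measurable_completion) (simp add: frac_maximal_borel)

context Apq_weight
begin

text \<open>Chosen so that w^q (w^(-q))^\<rho> = w^(-p'): an integral of (h w^(-q))^\<rho> against
  \<open>U\<close> is one of h^\<rho> against \<open>V\<close>. It is the exponent conjugate to 1 +
  q/p', the Muckenhoupt index of w^q.\<close>

definition "\<rho> = 1 + p' / q"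

lemma rho: "1 < \<rho>" "q * \<rho> = q + p'" "(1 - \<gamma> / real CARD('n)) * (q / \<rho>) = q / p'"
    "(1 / p') * ((q - p) / \<rho>) + p / \<rho> = q / p'"
proof -
  show "1 < \<rho>" "q * \<rho> = q + p'" using q_pos p'_gt_1 by (auto simp: \<rho>_def field_simps)
  have s: "0 < q + p'" using q_pos p'_gt_1 by simp
  have e: "1 / q + 1 / p' = (q + p') / (q * p')" "q / \<rho> = q * q / (q + p')" "1 / \<rho> = q / (q + p')"
    using q_pos p'_gt_1 s by (simp_all add: \<rho>_def field_simps)
  show "(1 - \<gamma> / real CARD('n)) * (q / \<rho>) = q / p'"
    unfolding gamma_eq e using q_pos p'_gt_1 s by simp
  have pp: "p * p' = p + p'" using p by (simp add: p'_def field_simps)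
  have "(1 / p') * ((q - p) / \<rho>) + p / \<rho> = ((q - p) / p' + p) * (1 / \<rho>)"
    by (simp add: add_divide_distrib)
  also have "(q - p) / p' + p = (q + p') / p'" using pp p'_gt_1 by (simp add: field_simps)
  also have "(q + p') / p' * (1 / \<rho>) = q / p'" unfolding e using s by simp
  finally show "(1 / p') * ((q - p) / \<rho>) + p / \<rho> = q / p'" .
qed

text \<open>The volume power 1 + q/p' is kept split: one factor forms a \<open>U\<close>-average of
  a Lebesgue integral, the other cancels the normalisation of the fractional average.\<close>

lemma Apq_power:
  assumes "0 < r"
  shows "measure U (ball c r) * measure V (ball c r) powr (q / p')
    \<le> C powr q * (measure lebesgue (ball c r) * measure lebesgue (ball c r) powr (q / p'))"
proof -
  have m: "0 < measure lebesgue (ball c r)" by (rule measure_lebesgue_ball_pos[OF assms])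
  have e: "(1 - \<gamma> / real CARD('n)) * q = 1 + q / p'"
    unfolding gamma_eq using q_pos by (simp add: distrib_right)
  have "(measure U (ball c r) powr (1 / q) * measure V (ball c r) powr (1 / p')) powr q
    \<le> (C * measure lebesgue (ball c r) powr (1 - \<gamma> / real CARD('n))) powr q"
    by (intro powr_mono2 Apq assms) (use q_pos in auto)
  then have "measure U (ball c r) * measure V (ball c r) powr (q / p')
    \<le> C powr q * measure lebesgue (ball c r) powr (1 + q / p')"
    unfolding powr_mult powr_powr e using q_pos by simp
  then show ?thesis using m by (simp only: powr_add powr_one_gt_zero_iff[THEN iffD2] )
qed

text \<open>For a ball B, read \<open>i\<close> as the integral of |f|, \<open>N\<close> as the norm
  of f, and \<open>m\<close>, \<open>uu\<close>, \<open>vv\<close> as the Lebesgue,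
  \<open>U\<close>- and \<open>V\<close>-masses. The power q/\<rho> of \<open>i\<close> is split
  into (q-p)/\<rho>, bounded through \<open>N\<close> by Hoelder, and p/\<rho>, kept as a power of
  the \<open>V\<close>-average; the hypothesis on \<open>K\<close> absorbs the remaining
  masses.\<close>

lemma pointwise_bound_real:
  fixes i N m uu vv :: real
  assumes "0 \<le> i" "0 \<le> N" "0 < m" "0 < uu" "0 < vv"
    and i: "i \<le> N * vv powr (1 / p')"
    and A: "uu * vv powr (q / p') \<le> K * (m * m powr (q / p'))"
  shows "(i / m powr (1 - \<gamma> / real CARD('n))) powr (q / \<rho>)
    \<le> K * N powr ((q - p) / \<rho>) * ((i / vv) powr (p / \<rho>) * m / uu)"
proof -
  have "q / \<rho> = (q - p) / \<rho> + p / \<rho>" by (simp add: add_divide_distrib[symmetric])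
  then have "i powr (q / \<rho>) = i powr ((q - p) / \<rho>) * i powr (p / \<rho>)" by (simp add: powr_add)
  also have "\<dots> \<le> (N * vv powr (1 / p')) powr ((q - p) / \<rho>) * i powr (p / \<rho>)"
    using assms q_gt_p rho(1) by (intro mult_right_mono powr_mono2) auto
  also have "\<dots> = N powr ((q - p) / \<rho>) * i powr (p / \<rho>) * vv powr ((1 / p') * ((q - p) / \<rho>))"
    using assms by (simp add: powr_mult powr_powr mult_ac)
  also have "vv powr ((1 / p') * ((q - p) / \<rho>)) = vv powr (q / p') / vv powr (p / \<rho>)"
    unfolding rho(4)[symmetric] using assms by (simp add: powr_add)
  finally have 1: "i powr (q / \<rho>) \<le>
     N powr ((q - p) / \<rho>) * i powr (p / \<rho>) * (vv powr (q / p') / vv powr (p / \<rho>))" .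
  have "vv powr (q / p') \<le> K * (m * m powr (q / p')) / uu"
    using A assms by (simp add: field_simps)
  then have "N powr ((q - p) / \<rho>) * i powr (p / \<rho>) * (vv powr (q / p') / vv powr (p / \<rho>)) \<le>
     N powr ((q - p) / \<rho>) * i powr (p / \<rho>) * ((K * (m * m powr (q / p')) / uu) / vv powr (p / \<rho>))"
    by (intro mult_left_mono divide_right_mono) auto
  also have "\<dots> = m powr (q / p') * (K * N powr ((q - p) / \<rho>) * ((i / vv) powr (p / \<rho>) * m / uu))"
    using assms by (simp add: powr_divide mult_ac)
  finally have "i powr (q / \<rho>) \<le> m powr (q / p') * (K * N powr ((q - p) / \<rho>) * ((i / vv) powr (p / \<rho>) * m / uu))"
    using 1 by simp
  moreover have "(i / m powr (1 - \<gamma> / real CARD('n))) powr (q / \<rho>) = i powr (q / \<rho>) / m powr (q / p')"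
    using assms by (simp only: powr_divide powr_powr rho(3))
  ultimately show ?thesis using assms by (simp add: divide_le_eq mult.commute)
qed

text \<open>Lerner's argument. On a ball \<open>B\<close> around \<open>x\<close> the \<open>V\<close>-average of \<open>g = \<bar>f\<bar> w powr p'\<close> is bounded by \<open>G\<close>
  throughout \<open>B\<close>, so its power \<open>p / \<rho>\<close> is at most a Lebesgue average of \<open>G\<close> to that power, that is, a
  \<open>U\<close>-average after division by \<open>w\<^sup>q\<close>; the exponent \<open>\<rho>\<close> is the one for which the remaining factors
  are controlled by the \<open>A\<close> condition.\<close>

lemma frac_maximal_pointwise:
  fixes f :: "real ^ 'n \<Rightarrow> real" and N :: real
  assumes f [measurable]: "f \<in> borel_measurable lebesgue"
    and N: "(\<integral>\<^sup>+x. ennreal (\<bar>f x\<bar> powr p) \<partial>W) = ennreal (N powr p)" "0 \<le> N"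
  defines "G \<equiv> weighted_maximal V (\<lambda>x. ennreal (\<bar>f x\<bar> * w x powr p'))"
  shows "epowr (frac_maximal \<gamma> f x) (q / \<rho>) \<le> ennreal (C powr q * N powr ((q - p) / \<rho>)) *
    weighted_maximal U (\<lambda>y. epowr (G y) (p / \<rho>) * ennreal (w y powr (- q))) x"
proof -
  let ?k = "\<lambda>y. epowr (G y) (p / \<rho>) * ennreal (w y powr (- q))"
  have pos: "0 < q / \<rho>" "0 < p / \<rho>" using q_pos p rho(1) by auto
  have G [measurable]: "G \<in> borel_measurable lebesgue"
    using V.weighted_maximal_measurable by (simp add: G_def measurable_cong_sets[OF sets_weight_measure refl])
  have main: "epowr ((\<integral>\<^sup>+y\<in>ball c r. ennreal \<bar>f y\<bar> \<partial>lebesgue)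
        / epowr (emeasure lebesgue (ball c r)) (1 - \<gamma> / real CARD('n))) (q / \<rho>)
      \<le> ennreal (C powr q * N powr ((q - p) / \<rho>)) * weighted_maximal U ?k x"
    if r: "0 < r" and x: "x \<in> ball c r" for c r
  proof -
    define m where "m = measure lebesgue (ball c r)"
    define uu where "uu = measure U (ball c r)"
    define vv where "vv = measure V (ball c r)"
    have mpos: "0 < m" unfolding m_def by (rule measure_lebesgue_ball_pos[OF r])
    have upos: "0 < uu" "0 < vv" unfolding uu_def vv_def using U_pos V_pos r by auto
    have M: "emeasure lebesgue (ball c r) = ennreal m" "emeasure U (ball c r) = ennreal uu" "emeasure V (ball c r) = ennreal vv"
      unfolding m_def uu_def vv_def using emeasure_lebesgue_ball_eq U_eq V_eq r by auto
    have "(\<integral>\<^sup>+y\<in>ball c r. ennreal \<bar>f y\<bar> \<partial>lebesgue) \<le>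
      epowr (\<integral>\<^sup>+y\<in>ball c r. ennreal (\<bar>f y\<bar> powr p) \<partial>W) (1 / p) * epowr (emeasure V (ball c r)) (1 / p')"
      by (rule Holder_ball) auto
    also have "\<dots> \<le> epowr (ennreal (N powr p)) (1 / p) * epowr (emeasure V (ball c r)) (1 / p')"
      unfolding N(1)[symmetric] using p by (intro mult_right_mono epowr_mono nn_integral_mono) (auto simp: indicator_def)
    also have "\<dots> = ennreal (N * vv powr (1 / p'))"
      using p p'_gt_1 N(2) upos by (simp add: M epowr_ennreal powr_powr ennreal_mult)
    finally have I: "(\<integral>\<^sup>+y\<in>ball c r. ennreal \<bar>f y\<bar> \<partial>lebesgue) \<le> ennreal (N * vv powr (1 / p'))" .
    then obtain i where i: "(\<integral>\<^sup>+y\<in>ball c r. ennreal \<bar>f y\<bar> \<partial>lebesgue) = ennreal i" "0 \<le> i" "i \<le> N * vv powr (1 / p')"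
      using N(2) by (cases "(\<integral>\<^sup>+y\<in>ball c r. ennreal \<bar>f y\<bar> \<partial>lebesgue)") (auto simp: top_unique ennreal_le_iff)
    have [measurable]: "ball c r \<in> sets lebesgue" by simp
    \<comment> \<open>The factor w^p' cancels the density of \<open>V\<close>, so the
      \<open>V\<close>-average of g is the plain integral of |f| divided by the
      \<open>V\<close>-mass.\<close>
    have gV: "(\<integral>\<^sup>+y\<in>ball c r. ennreal (\<bar>f y\<bar> * w y powr p') \<partial>V) = ennreal i"
    proof -
      have "(\<integral>\<^sup>+y\<in>ball c r. ennreal (\<bar>f y\<bar> * w y powr p') \<partial>V) =
        (\<integral>\<^sup>+y. ennreal (w y powr (- p')) * (ennreal (\<bar>f y\<bar> * w y powr p') * indicator (ball c r) y) \<partial>lebesgue)"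
        by (rule nn_integral_weight_measure) measurable
      also have "\<dots> = (\<integral>\<^sup>+y\<in>ball c r. ennreal \<bar>f y\<bar> \<partial>lebesgue)"
      proof (rule nn_integral_cong_AE, use w_pos in eventually_elim)
        fix y assume y: "0 < w y"
        have "ennreal (w y powr (- p')) * ennreal (\<bar>f y\<bar> * w y powr p') = ennreal \<bar>f y\<bar>"
          using y by (simp add: ennreal_mult'[symmetric] powr_minus field_simps)
        then show "ennreal (w y powr (- p')) * (ennreal (\<bar>f y\<bar> * w y powr p') * indicator (ball c r) y)
          = ennreal \<bar>f y\<bar> * indicator (ball c r) y"
          by (simp only: mult.assoc[symmetric])
      qed
      finally show ?thesis using i by simp
    qed
    have low: "ennreal ((i / vv) powr (p / \<rho>)) \<le> epowr (G y) (p / \<rho>)" if "y \<in> ball c r" for y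
    proof -
      have "ennreal (i / vv) \<le> G y"
        unfolding G_def weighted_maximal_def
        by (rule SUP_upper2[of "(c, r)"]) (use r that i upos in \<open>simp_all add: gV M divide_ennreal\<close>)
      then have "epowr (ennreal (i / vv)) (p / \<rho>) \<le> epowr (G y) (p / \<rho>)"
        using pos by (intro epowr_mono) auto
      then show ?thesis using i upos pos by (simp add: epowr_ennreal)
    qed
    have "ennreal ((i / vv) powr (p / \<rho>) * m) = (\<integral>\<^sup>+y\<in>ball c r. ennreal ((i / vv) powr (p / \<rho>)) \<partial>lebesgue)"
      using mpos by (simp add: nn_integral_cmult_indicator M ennreal_mult del: emeasure_completion)
    also have "\<dots> \<le> (\<integral>\<^sup>+y\<in>ball c r. epowr (G y) (p / \<rho>) \<partial>lebesgue)"
      by (intro nn_integral_mono) (auto simp: indicator_def low simp del: mem_ball)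
    also have "\<dots> = (\<integral>\<^sup>+y. ennreal (w y powr q) * (?k y * indicator (ball c r) y) \<partial>lebesgue)"
    proof (rule nn_integral_cong_AE, use w_pos in eventually_elim)
      fix y assume y: "0 < w y"
      then have "ennreal (w y powr q) * ennreal (w y powr (- q)) = 1"
        by (simp add: ennreal_mult'[symmetric] powr_minus)
      moreover have "ennreal (w y powr q) * (?k y * indicator (ball c r) y) =
         (ennreal (w y powr q) * ennreal (w y powr (- q))) * (epowr (G y) (p / \<rho>) * indicator (ball c r) y)"
        by (simp only: mult_ac)
      ultimately show "epowr (G y) (p / \<rho>) * indicator (ball c r) y = ennreal (w y powr q) * (?k y * indicator (ball c r) y)"
        by simp
    qed
    also have "\<dots> = (\<integral>\<^sup>+y\<in>ball c r. ?k y \<partial>U)"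
      by (rule nn_integral_weight_measure[symmetric]) auto
    finally have "ennreal ((i / vv) powr (p / \<rho>) * m) / ennreal uu \<le> (\<integral>\<^sup>+y\<in>ball c r. ?k y \<partial>U) / ennreal uu"
      by (rule divide_right_mono_ennreal)
    also have "\<dots> \<le> weighted_maximal U ?k x"
      unfolding weighted_maximal_def by (rule SUP_upper2[of "(c, r)"]) (use r x M in auto)
    finally have max: "ennreal ((i / vv) powr (p / \<rho>) * m / uu) \<le> weighted_maximal U ?k x"
      using upos mpos by (simp add: divide_ennreal)
    have "epowr ((\<integral>\<^sup>+y\<in>ball c r. ennreal \<bar>f y\<bar> \<partial>lebesgue)
        / epowr (emeasure lebesgue (ball c r)) (1 - \<gamma> / real CARD('n))) (q / \<rho>)
      = ennreal ((i / m powr (1 - \<gamma> / real CARD('n))) powr (q / \<rho>))"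
      unfolding i(1) M(1) using mpos i pos by (simp add: epowr_ennreal_pos divide_ennreal epowr_ennreal)
    also have "\<dots> \<le> ennreal (C powr q * N powr ((q - p) / \<rho>) * ((i / vv) powr (p / \<rho>) * m / uu))"
      by (intro ennreal_leI pointwise_bound_real i N mpos upos)
         (use Apq_power[OF r, of c] in \<open>simp add: m_def uu_def vv_def\<close>)
    also have "\<dots> = ennreal (C powr q * N powr ((q - p) / \<rho>)) * ennreal ((i / vv) powr (p / \<rho>) * m / uu)"
      using mpos upos by (intro ennreal_mult) auto
    also have "\<dots> \<le> ennreal (C powr q * N powr ((q - p) / \<rho>)) * weighted_maximal U ?k x"
      by (intro mult_left_mono max) simp
    finally show ?thesis .
  qed
  show ?thesis
    unfolding frac_maximal_def epowr_SUP[OF pos(1)]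
    by (rule SUP_least) (use main in auto)
qed

text \<open>The pointwise bound is raised to the power \<rho>. The maximal operator of
  \<open>U\<close> on L^\<rho> is removed, the choice of \<rho> turns what remains into the integral
  of \<open>G\<close>^p against \<open>V\<close>, and the maximal operator of \<open>V\<close> on
  L^p is removed next; finally w^(-p') (w^p')^p = w^p. Homogeneity is restored by N^(q-p) N^p =
  N^q.\<close>

lemma frac_maximal_strong_type:
  "\<exists>K>0. \<forall>f\<in>borel_measurable lebesgue.
    (\<integral>\<^sup>+x. epowr (frac_maximal \<gamma> f x) q \<partial>U)
      \<le> ennreal K * epowr (\<integral>\<^sup>+x. ennreal (\<bar>f x\<bar> powr p) \<partial>W) (q / p)"
proof -
  obtain KU where KU: "0 < KU" "\<And>g. g \<in> borel_measurable U \<Longrightarrow>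
      (\<integral>\<^sup>+x. epowr (weighted_maximal U g x) \<rho> \<partial>U) \<le> ennreal KU * (\<integral>\<^sup>+x. epowr (g x) \<rho> \<partial>U)"
    using U.strong_type[OF rho(1)] by blast
  obtain KV where KV: "0 < KV" "\<And>g. g \<in> borel_measurable V \<Longrightarrow>
      (\<integral>\<^sup>+x. epowr (weighted_maximal V g x) p \<partial>V) \<le> ennreal KV * (\<integral>\<^sup>+x. epowr (g x) p \<partial>V)"
    using V.strong_type[OF p(1)] by blast
  define K where "K = (C powr q) powr \<rho> * (KU * KV)"
  have K: "0 < K" using C KU(1) KV(1) by (simp add: K_def)
  have "(\<integral>\<^sup>+x. epowr (frac_maximal \<gamma> f x) q \<partial>U)
      \<le> ennreal K * epowr (\<integral>\<^sup>+x. ennreal (\<bar>f x\<bar> powr p) \<partial>W) (q / p)"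
    if f [measurable]: "f \<in> borel_measurable lebesgue" for f
  proof (cases "(\<integral>\<^sup>+x. ennreal (\<bar>f x\<bar> powr p) \<partial>W)")
    case top
    then show ?thesis using K p q_pos by (simp add: ennreal_mult_top)
  next
    case (real n0)
    define N where "N = n0 powr (1 / p)"
    have N: "(\<integral>\<^sup>+x. ennreal (\<bar>f x\<bar> powr p) \<partial>W) = ennreal (N powr p)" "0 \<le> N"
      using real p by (auto simp: N_def powr_powr)
    let ?g = "\<lambda>x. ennreal (\<bar>f x\<bar> * w x powr p')"
    define G where "G = weighted_maximal V ?g"
    have G [measurable]: "G \<in> borel_measurable lebesgue"
      using V.weighted_maximal_measurable by (simp add: G_def measurable_cong_sets[OF sets_weight_measure refl])
    let ?k = "\<lambda>y. epowr (G y) (p / \<rho>) * ennreal (w y powr (- q))"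
    have Mk [measurable]: "weighted_maximal U ?k \<in> borel_measurable lebesgue"
      using U.weighted_maximal_measurable by (simp add: measurable_cong_sets[OF sets_weight_measure refl])
    let ?c = "C powr q * N powr ((q - p) / \<rho>)"
    have c: "?c powr \<rho> = (C powr q) powr \<rho> * N powr (q - p)"
      using rho(1) by (simp add: powr_mult powr_powr)
    have "(\<integral>\<^sup>+x. epowr (frac_maximal \<gamma> f x) q \<partial>U)
       \<le> (\<integral>\<^sup>+x. ennreal (?c powr \<rho>) * epowr (weighted_maximal U ?k x) \<rho> \<partial>U)"
    proof (rule nn_integral_mono)
      fix x
      have "epowr (frac_maximal \<gamma> f x) q = epowr (epowr (frac_maximal \<gamma> f x) (q / \<rho>)) \<rho>"
        using q_pos rho(1) by (simp add: epowr_epowr)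
      also have "\<dots> \<le> epowr (ennreal ?c * weighted_maximal U ?k x) \<rho>"
        using frac_maximal_pointwise[OF f N, of x, folded G_def] rho(1) by (intro epowr_mono) auto
      also have "\<dots> = ennreal (?c powr \<rho>) * epowr (weighted_maximal U ?k x) \<rho>"
        using rho(1) by (simp add: epowr_mult epowr_ennreal)
      finally show "epowr (frac_maximal \<gamma> f x) q \<le> ennreal (?c powr \<rho>) * epowr (weighted_maximal U ?k x) \<rho>" .
    qed
    also have "\<dots> = ennreal (?c powr \<rho>) * (\<integral>\<^sup>+x. epowr (weighted_maximal U ?k x) \<rho> \<partial>U)"
      by (rule nn_integral_cmult) measurable
    also have "\<dots> \<le> ennreal (?c powr \<rho>) * (ennreal KU * (\<integral>\<^sup>+x. epowr (?k x) \<rho> \<partial>U))"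
      by (intro mult_left_mono KU(2)) auto
    also have "(\<integral>\<^sup>+x. epowr (?k x) \<rho> \<partial>U) = (\<integral>\<^sup>+x. ennreal (w x powr q) * epowr (?k x) \<rho> \<partial>lebesgue)"
      by (rule nn_integral_weight_measure) auto
    also have "\<dots> = (\<integral>\<^sup>+x. ennreal (w x powr (- p')) * epowr (G x) p \<partial>lebesgue)"
    proof (rule nn_integral_cong_AE, use w_pos in eventually_elim)
      fix y assume y: "0 < w y"
      have "q + - q * \<rho> = - p'" using rho(2) by simp
      then have "w y powr q * (w y powr (- q)) powr \<rho> = w y powr (- p')"
        using y by (simp only: powr_powr powr_add[symmetric])
      then show "ennreal (w y powr q) * epowr (?k y) \<rho> = ennreal (w y powr (- p')) * epowr (G y) p"
        using y rho(1) p by (simp add: epowr_mult epowr_epowr epowr_ennreal_pos ennreal_mult'[symmetric] mult.left_commute) (simp add: mult.commute)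
    qed
    also have "\<dots> = (\<integral>\<^sup>+x. epowr (G x) p \<partial>V)"
      by (rule nn_integral_weight_measure[symmetric]) auto
    also have "\<dots> \<le> ennreal KV * (\<integral>\<^sup>+x. epowr (?g x) p \<partial>V)"
      unfolding G_def by (rule KV(2)) auto
    also have "(\<integral>\<^sup>+x. epowr (?g x) p \<partial>V) = (\<integral>\<^sup>+x. ennreal (w x powr (- p')) * epowr (?g x) p \<partial>lebesgue)"
      by (rule nn_integral_weight_measure) auto
    also have "\<dots> = (\<integral>\<^sup>+x. ennreal (w x powr p) * ennreal (\<bar>f x\<bar> powr p) \<partial>lebesgue)"
    proof (rule nn_integral_cong_AE, use w_pos in eventually_elim)
      fix y assume y: "0 < w y"
      have "- p' + p' * p = p' * (p - 1)" by (simp add: algebra_simps)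
      also have "\<dots> = p" using p by (simp add: p'_def)
      finally have "- p' + p' * p = p" .
      then have "w y powr (- p') * (w y powr p') powr p = w y powr p"
        using y by (simp only: powr_powr powr_add[symmetric])
      then have "w y powr (- p') * (\<bar>f y\<bar> * w y powr p') powr p = w y powr p * \<bar>f y\<bar> powr p"
        by (simp add: powr_mult mult_ac)
      then show "ennreal (w y powr (- p')) * epowr (?g y) p = ennreal (w y powr p) * ennreal (\<bar>f y\<bar> powr p)"
        using p by (simp add: epowr_ennreal ennreal_mult'[symmetric])
    qed
    also have "\<dots> = ennreal (N powr p)"
      unfolding N(1)[symmetric] by (rule nn_integral_weight_measure[symmetric]) auto
    finally have "(\<integral>\<^sup>+x. epowr (frac_maximal \<gamma> f x) q \<partial>U) \<le>
       ennreal (?c powr \<rho>) * (ennreal KU * (ennreal KV * ennreal (N powr p)))"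
      by (simp add: mult_left_mono)
    also have "\<dots> = ennreal (K * N powr q)"
    proof -
      have "N powr q = N powr (q - p) * N powr p" by (simp add: powr_add[symmetric])
      then have "K * N powr q = ?c powr \<rho> * (KU * (KV * N powr p))"
        unfolding c K_def by simp
      then show ?thesis using KU(1) KV(1) by (simp add: ennreal_mult)
    qed
    also have "\<dots> = ennreal K * epowr (ennreal (N powr p)) (q / p)"
      using K p q_pos by (simp add: epowr_ennreal powr_powr ennreal_mult)
    finally show ?thesis by (simp add: N(1))
  qed
  with K show ?thesis by blast
qed

text \<open>A ball of radius t \<le> r/2 through x stays inside the ball of radius 2r about y. A
  larger one has r < 2t, so its points are within 2t + r < 4t of y, and it lies in a dilate of
  radius between 4t and 8t; the volume ratio is at most 8^n.\<close>

lemma frac_maximal_decompose: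
  fixes f :: "real ^ 'n \<Rightarrow> real"
  assumes r: "0 < r" and x: "x \<in> ball y r"
  shows "frac_maximal \<gamma> f x \<le> max (frac_maximal \<gamma> (\<lambda>z. f z * indicator (ball y (2 * r)) z) x)
     (ennreal ((8 ^ CARD('n)) powr (1 - \<gamma> / real CARD('n))) *
        (SUP k. (\<integral>\<^sup>+z\<in>ball y (2 ^ Suc k * r). ennreal \<bar>f z\<bar> \<partial>lebesgue)
           / epowr (emeasure lebesgue (ball y (2 ^ Suc k * r))) (1 - \<gamma> / real CARD('n))))"
    (is "_ \<le> max ?loc (ennreal ?c * (SUP k. ?A k))")
proof -
  let ?a = "1 - \<gamma> / real CARD('n)"
  have a: "0 < ?a" using gamma by simp
  have "(\<integral>\<^sup>+z\<in>ball c t. ennreal \<bar>f z\<bar> \<partial>lebesgue) / epowr (emeasure lebesgue (ball c t)) ?a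
     \<le> max ?loc (ennreal ?c * (SUP k. ?A k))" if t: "0 < t" and xc: "x \<in> ball c t" for c t
  proof (cases "t \<le> r / 2")
    case True
    have "z \<in> ball y (2 * r)" if "z \<in> ball c t" for z
      using that xc x True dist_triangle[of y z x] dist_triangle[of x z c] by (simp add: dist_commute)
    then have "(\<integral>\<^sup>+z\<in>ball c t. ennreal \<bar>f z\<bar> \<partial>lebesgue)
      = (\<integral>\<^sup>+z\<in>ball c t. ennreal \<bar>f z * indicator (ball y (2 * r)) z\<bar> \<partial>lebesgue)"
      by (intro nn_integral_cong) (auto simp: indicator_def)
    then have "(\<integral>\<^sup>+z\<in>ball c t. ennreal \<bar>f z\<bar> \<partial>lebesgue) / epowr (emeasure lebesgue (ball c t)) ?a \<le> ?loc"
      unfolding frac_maximal_def by (intro SUP_upper2[of "(c, t)"]) (use t xc in auto)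
    then show ?thesis by (simp add: le_max_iff_disj)
  next
    case False
    have "\<exists>k. 4 * t \<le> 2 ^ Suc k * r"
    proof -
      obtain k where "4 * t / r < 2 ^ k" using real_arch_pow[of 2] by auto
      then have "4 * t < 2 ^ k * r" using r by (simp add: field_simps)
      then have "4 * t \<le> 2 * (2 ^ k * r)" using r t by linarith
      then show ?thesis by (intro exI[of _ k]) (simp only: power_Suc mult.assoc)
    qed
    \<comment> \<open>Minimality of \<open>k\<close> supplies the upper bound 8t on the radius of
      the dilate, hence comparable volumes.\<close>
    then obtain k where k: "4 * t \<le> 2 ^ Suc k * r" "\<And>j. j < k \<Longrightarrow> 2 ^ Suc j * r < 4 * t"
      using exists_least_iff[of "\<lambda>k. 4 * t \<le> 2 ^ Suc k * r"] by (auto simp: not_le)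
    have k8: "2 ^ Suc k * r \<le> 8 * t"
    proof (cases k)
      case 0 then show ?thesis using False k(1) by simp
    next
      case (Suc j) then show ?thesis using k(2)[of j] by simp
    qed
    have sub: "ball c t \<subseteq> ball y (2 ^ Suc k * r)"
    proof
      fix z assume "z \<in> ball c t"
      then have "dist y z < 2 * t + r"
        using xc x dist_triangle[of y z x] dist_triangle[of x z c] by (simp add: dist_commute)
      then have "dist y z < 2 ^ Suc k * r" using k(1) False by linarith
      then show "z \<in> ball y (2 ^ Suc k * r)" by (simp only: mem_ball)
    qed
    let ?m = "measure lebesgue (ball c t)" and ?M = "measure lebesgue (ball y (2 ^ Suc k * r))"
    have m: "0 < ?m" "0 < ?M" using t r by (auto intro!: measure_lebesgue_ball_pos)
    have "?M \<le> measure lebesgue (ball y (8 * t))"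
      using k8 by (intro measure_mono_fmeasurable subset_ball) auto
    also have "\<dots> = 8 ^ CARD('n) * ?m" using t by (intro measure_lebesgue_ball_mult) auto
    finally have "?M powr ?a \<le> (8 ^ CARD('n) * ?m) powr ?a" using a m by (intro powr_mono2) auto
    then have "?M powr ?a \<le> ?c * ?m powr ?a" using m by (simp add: powr_mult)
    then have le: "1 / ?m powr ?a \<le> ?c * (1 / ?M powr ?a)" using m by (simp add: field_simps)
    have "(\<integral>\<^sup>+z\<in>ball c t. ennreal \<bar>f z\<bar> \<partial>lebesgue) / epowr (emeasure lebesgue (ball c t)) ?a
      = ennreal (1 / ?m powr ?a) * (\<integral>\<^sup>+z\<in>ball c t. ennreal \<bar>f z\<bar> \<partial>lebesgue)"
      unfolding emeasure_lebesgue_ball_eq[OF t] epowr_ennreal_pos[OF m(1)]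
      by (rule ennreal_divide_ennreal) (use m in simp)
    also have "\<dots> \<le> ennreal (?c * (1 / ?M powr ?a)) * (\<integral>\<^sup>+z\<in>ball y (2 ^ Suc k * r). ennreal \<bar>f z\<bar> \<partial>lebesgue)"
      by (intro mult_mono ennreal_leI le nn_integral_mono) (use sub in \<open>auto simp: indicator_def\<close>)
    also have "\<dots> = ennreal ?c * ?A k"
    proof -
      have r': "0 < 2 ^ Suc k * r" using r by simp
      have "?A k = ennreal (1 / ?M powr ?a) * (\<integral>\<^sup>+z\<in>ball y (2 ^ Suc k * r). ennreal \<bar>f z\<bar> \<partial>lebesgue)"
        unfolding emeasure_lebesgue_ball_eq[OF r'] epowr_ennreal_pos[OF m(2)]
        by (rule ennreal_divide_ennreal) (use m in simp)
      then show ?thesis by (simp only: ennreal_mult'[OF powr_ge_zero] mult.assoc)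
    qed
    also have "\<dots> \<le> ennreal ?c * (SUP k. ?A k)" by (intro mult_left_mono SUP_upper) auto
    finally show ?thesis by (simp add: le_max_iff_disj)
  qed
  then show ?thesis
    unfolding frac_maximal_def by (intro SUP_least) auto
qed

text \<open>After Hoelder, the class condition trades the volume and the \<open>V\<close>-mass for
  the power -1/q of the \<open>U\<close>-mass, and the q-th power makes this a reciprocal.\<close>

lemma fractional_average_le:
  fixes f :: "real ^ 'n \<Rightarrow> real"
  assumes f [measurable]: "f \<in> borel_measurable lebesgue" and r: "0 < r"
  shows "epowr ((\<integral>\<^sup>+z\<in>ball y r. ennreal \<bar>f z\<bar> \<partial>lebesgue)
           / epowr (emeasure lebesgue (ball y r)) (1 - \<gamma> / real CARD('n))) q
    \<le> ennreal (C powr q * (1 / measure U (ball y r))) *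
       epowr (\<integral>\<^sup>+z\<in>ball y r. ennreal (\<bar>f z\<bar> powr p) \<partial>W) (q / p)"
proof -
  let ?a = "1 - \<gamma> / real CARD('n)" and ?J = "\<integral>\<^sup>+z\<in>ball y r. ennreal (\<bar>f z\<bar> powr p) \<partial>W"
  define m where "m = measure lebesgue (ball y r)"
  define uu where "uu = measure U (ball y r)"
  define vv where "vv = measure V (ball y r)"
  have m: "0 < m" unfolding m_def by (rule measure_lebesgue_ball_pos[OF r])
  have uv: "0 < uu" "0 < vv" unfolding uu_def vv_def using U_pos V_pos r by auto
  have "uu powr (1 / q) * vv powr (1 / p') \<le> C * m powr ?a"
    unfolding uu_def vv_def m_def by (rule Apq[OF r])
  then have le: "1 / m powr ?a * vv powr (1 / p') \<le> C * (1 / uu powr (1 / q))"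
    using m uv by (simp add: field_simps)
  have "(\<integral>\<^sup>+z\<in>ball y r. ennreal \<bar>f z\<bar> \<partial>lebesgue) / epowr (emeasure lebesgue (ball y r)) ?a
      = ennreal (1 / m powr ?a) * (\<integral>\<^sup>+z\<in>ball y r. ennreal \<bar>f z\<bar> \<partial>lebesgue)"
    unfolding emeasure_lebesgue_ball_eq[OF r] m_def[symmetric] epowr_ennreal_pos[OF m(1)]
    by (rule ennreal_divide_ennreal) (use m in simp)
  also have "\<dots> \<le> ennreal (1 / m powr ?a) * (epowr ?J (1 / p) * epowr (emeasure V (ball y r)) (1 / p'))"
    by (intro mult_left_mono Holder_ball) auto
  also have "\<dots> = ennreal (1 / m powr ?a * vv powr (1 / p')) * epowr ?J (1 / p)"
    unfolding V_eq[OF r] vv_def[symmetric] epowr_ennreal_pos[OF uv(2)]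
    by (simp only: ennreal_mult''[OF powr_ge_zero]) (simp only: mult_ac)
  also have "\<dots> \<le> ennreal (C * (1 / uu powr (1 / q))) * epowr ?J (1 / p)"
    by (intro mult_right_mono ennreal_leI le) auto
  finally have "epowr ((\<integral>\<^sup>+z\<in>ball y r. ennreal \<bar>f z\<bar> \<partial>lebesgue) / epowr (emeasure lebesgue (ball y r)) ?a) q
     \<le> epowr (ennreal (C * (1 / uu powr (1 / q))) * epowr ?J (1 / p)) q"
    using q_pos by (intro epowr_mono) auto
  also have "\<dots> = ennreal ((C * (1 / uu powr (1 / q))) powr q) * epowr ?J (q / p)"
    using q_pos p C uv by (simp add: epowr_mult epowr_epowr epowr_ennreal)
  also have "(C * (1 / uu powr (1 / q))) powr q = C powr q * (1 / uu)"
    using q_pos C uv by (simp add: powr_mult powr_divide powr_powr)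
  finally show ?thesis by (simp add: uu_def)
qed

text \<open>The far part in \<open>frac_maximal_decompose\<close> is constant on the ball, so
  integrating it only multiplies by the \<open>U\<close>-mass of the ball; together with
  \<open>fractional_average_le\<close> this yields the ratio of masses. The near part is controlled
  by the strong type inequality and fits the term k = 0.\<close>

lemma frac_maximal_ball_estimate:
  "\<exists>K>0. \<forall>f\<in>borel_measurable lebesgue. \<forall>y r. 0 < r \<longrightarrow>
    (\<integral>\<^sup>+x\<in>ball y r. epowr (frac_maximal \<gamma> f x) q \<partial>U) \<le> ennreal K *
      (SUP k. ennreal (measure U (ball y r) / measure U (ball y (2 ^ Suc k * r))) *
        epowr (\<integral>\<^sup>+z\<in>ball y (2 ^ Suc k * r). ennreal (\<bar>f z\<bar> powr p) \<partial>W) (q / p))"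
proof -
  obtain K0 where K0: "0 < K0" "\<And>f. f \<in> borel_measurable lebesgue \<Longrightarrow>
    (\<integral>\<^sup>+x. epowr (frac_maximal \<gamma> f x) q \<partial>U) \<le> ennreal K0 * epowr (\<integral>\<^sup>+x. ennreal (\<bar>f x\<bar> powr p) \<partial>W) (q / p)"
    using frac_maximal_strong_type by blast
  define c where "c = (8 ^ CARD('n)) powr (1 - \<gamma> / real CARD('n))"
  have c: "0 < c" by (simp add: c_def)
  have DU: "0 < DU" using C'_pos by (simp add: DU_def)
  define K where "K = K0 * DU + c powr q * C powr q"
  have K: "0 < K" using K0 DU by (auto simp: K_def intro!: add_pos_nonneg)
  have "(\<integral>\<^sup>+x\<in>ball y r. epowr (frac_maximal \<gamma> f x) q \<partial>U) \<le> ennreal K *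
      (SUP k. ennreal (measure U (ball y r) / measure U (ball y (2 ^ Suc k * r))) *
        epowr (\<integral>\<^sup>+z\<in>ball y (2 ^ Suc k * r). ennreal (\<bar>f z\<bar> powr p) \<partial>W) (q / p))"
    if f [measurable]: "f \<in> borel_measurable lebesgue" and r: "0 < r" for f y r
  proof -
    define J where "J k = (\<integral>\<^sup>+z\<in>ball y (2 ^ Suc k * r). ennreal (\<bar>f z\<bar> powr p) \<partial>W)" for k
    define uu where "uu = measure U (ball y r)"
    define ub where "ub k = measure U (ball y (2 ^ Suc k * r))" for k
    have upos: "0 < uu" "\<And>k. 0 < ub k" using r by (auto simp: uu_def ub_def intro!: U_pos)
    define S where "S = (SUP k. ennreal (uu / ub k) * epowr (J k) (q / p))"
    define A where "A k = (\<integral>\<^sup>+z\<in>ball y (2 ^ Suc k * r). ennreal \<bar>f z\<bar> \<partial>lebesgue)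
           / epowr (emeasure lebesgue (ball y (2 ^ Suc k * r))) (1 - \<gamma> / real CARD('n))" for k
    let ?loc = "\<lambda>z. f z * indicator (ball y (2 * r)) z"
    have [measurable]: "ball y (2 * r) \<in> sets lebesgue" "ball y r \<in> sets lebesgue" by auto
    have loc [measurable]: "?loc \<in> borel_measurable lebesgue" by measurable
    have "(\<integral>\<^sup>+x\<in>ball y r. epowr (frac_maximal \<gamma> f x) q \<partial>U) \<le>
       (\<integral>\<^sup>+x. epowr (frac_maximal \<gamma> ?loc x) q + epowr (ennreal c * (SUP k. A k)) q * indicator (ball y r) x \<partial>U)"
    proof (rule nn_integral_mono)
      fix x
      show "epowr (frac_maximal \<gamma> f x) q * indicator (ball y r) x \<le>
         epowr (frac_maximal \<gamma> ?loc x) q + epowr (ennreal c * (SUP k. A k)) q * indicator (ball y r) x"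
      proof (cases "x \<in> ball y r")
        case True
        have "epowr (frac_maximal \<gamma> f x) q \<le> epowr (max (frac_maximal \<gamma> ?loc x) (ennreal c * (SUP k. A k))) q"
          using frac_maximal_decompose[OF r True, of f] q_pos
          by (intro epowr_mono) (auto simp: A_def c_def)
        also have "\<dots> \<le> epowr (frac_maximal \<gamma> ?loc x) q + epowr (ennreal c * (SUP k. A k)) q"
          by (auto simp: max_def add_increasing add_increasing2)
        finally show ?thesis using True by simp
      qed simp
    qed
    also have "\<dots> = (\<integral>\<^sup>+x. epowr (frac_maximal \<gamma> ?loc x) q \<partial>U) +
       epowr (ennreal c * (SUP k. A k)) q * emeasure U (ball y r)"
      by (subst nn_integral_add) (auto simp: nn_integral_cmult_indicator)
    also have "\<dots> \<le> ennreal (K0 * DU) * S + ennreal (c powr q * C powr q) * S"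
    proof (rule add_mono)
      have J0: "(\<integral>\<^sup>+x. ennreal (\<bar>?loc x\<bar> powr p) \<partial>W) = J 0"
        unfolding J_def using p by (intro nn_integral_cong) (auto simp: indicator_def)
      have "ub 0 \<le> DU * uu" unfolding ub_def uu_def using U_doubling[OF r, of y] by simp
      \<comment> \<open>The strong type bound carries no ratio of masses; doubling inserts the one
        for k = 0 at the cost of \<open>DU\<close>.\<close>
      then have "1 \<le> DU * (uu / ub 0)" using upos(2)[of 0] by (simp add: field_simps)
      then have "1 \<le> ennreal (DU * (uu / ub 0))" by simp
      have "(\<integral>\<^sup>+x. epowr (frac_maximal \<gamma> ?loc x) q \<partial>U) \<le> ennreal K0 * (1 * epowr (J 0) (q / p))"
        using K0(2)[OF loc] unfolding J0 by simp
      also have "\<dots> \<le> ennreal K0 * (ennreal (DU * (uu / ub 0)) * epowr (J 0) (q / p))"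
        by (intro mult_left_mono mult_right_mono) (use \<open>1 \<le> ennreal _\<close> in auto)
      also have "\<dots> = ennreal (K0 * DU) * (ennreal (uu / ub 0) * epowr (J 0) (q / p))"
      proof -
        have "0 \<le> uu / ub 0" using upos(1) upos(2)[of 0] by simp
        then have "ennreal (DU * (uu / ub 0)) = ennreal DU * ennreal (uu / ub 0)"
          using DU by (intro ennreal_mult) auto
        then show ?thesis using K0 by (simp only: ennreal_mult'[OF less_imp_le[OF K0(1)]] mult.assoc)
      qed
      also have "\<dots> \<le> ennreal (K0 * DU) * S"
        unfolding S_def by (intro mult_left_mono SUP_upper) auto
      finally show "(\<integral>\<^sup>+x. epowr (frac_maximal \<gamma> ?loc x) q \<partial>U) \<le> ennreal (K0 * DU) * S" .
      have "epowr (ennreal c * (SUP k. A k)) q * emeasure U (ball y r) =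
         ennreal (c powr q) * (SUP k. ennreal uu * epowr (A k) q)"
        using q_pos c by (simp add: epowr_mult epowr_ennreal epowr_SUP U_eq[OF r] uu_def
            SUP_mult_left_ennreal mult_ac)
      also have "\<dots> \<le> ennreal (c powr q) * (ennreal (C powr q) * S)"
      proof (intro mult_left_mono SUP_least)
        fix k
        have "ennreal uu * epowr (A k) q \<le> ennreal uu * (ennreal (C powr q * (1 / ub k)) * epowr (J k) (q / p))"
          unfolding A_def ub_def J_def by (intro mult_left_mono fractional_average_le f) (use r in auto)
        also have "\<dots> = ennreal (C powr q) * (ennreal (uu / ub k) * epowr (J k) (q / p))"
        proof -
          have "ennreal uu * ennreal (C powr q * (1 / ub k)) = ennreal (C powr q) * ennreal (uu / ub k)"
            using upos(1) upos(2)[of k] by (simp add: ennreal_mult'[symmetric])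
          then show ?thesis by (simp only: mult.assoc[symmetric])
        qed
        also have "\<dots> \<le> ennreal (C powr q) * S"
          unfolding S_def by (intro mult_left_mono SUP_upper) auto
        finally show "ennreal uu * epowr (A k) q \<le> ennreal (C powr q) * S" .
      qed simp
      finally show "epowr (ennreal c * (SUP k. A k)) q * emeasure U (ball y r) \<le> ennreal (c powr q * C powr q) * S"
        by (simp add: ennreal_mult mult.assoc)
    qed
    also have "\<dots> = ennreal K * S"
      using K0(1) DU by (simp add: K_def distrib_right ennreal_plus)
    finally show ?thesis by (simp add: S_def uu_def ub_def J_def)
  qed
  with K show ?thesis by blast
qed

lemma U_dilate:
  assumes \<delta>: "0 < \<delta>" "\<And>c r. 0 < r \<Longrightarrow> measure U (ball c r) \<le> \<delta> * measure U (ball c (2 * r))" and r: "0 < r"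
  shows "measure U (ball y r) \<le> \<delta> ^ k * measure U (ball y (2 ^ k * r))"
proof (induction k)
  case (Suc k)
  have "measure U (ball y (2 ^ k * r)) \<le> \<delta> * measure U (ball y (2 * (2 ^ k * r)))"
    using r by (intro \<delta>) simp
  then have "\<delta> ^ k * measure U (ball y (2 ^ k * r)) \<le> \<delta> ^ k * (\<delta> * measure U (ball y (2 * (2 ^ k * r))))"
    using \<delta>(1) by (intro mult_left_mono) auto
  with Suc show ?case by (simp add: mult_ac)
qed simp

end

subsection \<open>Amalgam norms\<close>

text \<open>Lower semicontinuity in the centre: a mass above \<open>a\<close> is already attained on
  a slightly smaller concentric ball, which stays inside every ball of radius r whose centre is
  close enough.\<close>

lemma emeasure_ball_measurable:
  fixes M :: "'a::metric_space measure"
  assumes "sets borel \<subseteq> sets M"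
  shows "(\<lambda>y. emeasure M (ball y r)) \<in> borel_measurable borel"
proof (rule borel_measurableI_greater)
  fix a
  have ball_sets: "ball y t \<in> sets M" for y t using assms borel_open[OF open_ball[of y t]] by blast
  have "open {y. a < emeasure M (ball y r)}"
    unfolding open_dist Ball_def mem_Collect_eq
  proof (intro allI impI)
    fix y assume y: "a < emeasure M (ball y r)"
    have "(\<Union>n. ball y (r - 1 / real (Suc n))) = ball y r"
    proof
      show "ball y r \<subseteq> (\<Union>n. ball y (r - 1 / real (Suc n)))"
      proof
        fix z assume "z \<in> ball y r"
        then have "0 < r - dist y z" by simp
        then obtain n where "inverse (real (Suc n)) < r - dist y z" using reals_Archimedean by blast
        then show "z \<in> (\<Union>n. ball y (r - 1 / real (Suc n)))"
          by (intro UN_I[of n]) (auto simp: inverse_eq_divide)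
      qed
      show "(\<Union>n. ball y (r - 1 / real (Suc n))) \<subseteq> ball y r"
        by (intro UN_least subset_ball) simp
    qed
    moreover have "incseq (\<lambda>n. ball y (r - 1 / real (Suc n)))"
      by (intro incseq_SucI subset_ball diff_left_mono divide_left_mono) auto
    ultimately have "emeasure M (ball y r) = (SUP n. emeasure M (ball y (r - 1 / real (Suc n))))"
      by (subst SUP_emeasure_incseq) (auto simp: ball_sets)
    then obtain n where n: "a < emeasure M (ball y (r - 1 / real (Suc n)))"
      using y by (auto simp: less_SUP_iff)
    show "\<exists>e>0. \<forall>x. dist x y < e \<longrightarrow> a < emeasure M (ball x r)"
    proof (intro exI[of _ "1 / real (Suc n)"] conjI allI impI)
      fix x assume x: "dist x y < 1 / real (Suc n)"
      have "ball y (r - 1 / real (Suc n)) \<subseteq> ball x r"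
      proof
        fix z assume "z \<in> ball y (r - 1 / real (Suc n))"
        then have "dist x z < r" using x dist_triangle[of x z y] by simp
        then show "z \<in> ball x r" by simp
      qed
      then have "emeasure M (ball y (r - 1 / real (Suc n))) \<le> emeasure M (ball x r)"
        by (intro emeasure_mono ball_sets)
      with n show "a < emeasure M (ball x r)" by simp
    qed simp
  qed
  then show "{y \<in> space borel. a < emeasure M (ball y r)} \<in> sets borel" by simp
qed

lemma Lnorm_indicator:
  assumes [measurable]: "g \<in> borel_measurable M" "B \<in> sets M" and p: "0 < p"
  shows "Lnorm (ereal p) M (\<lambda>x. g x * indicator B x) = epowr (\<integral>\<^sup>+x\<in>B. epowr (g x) p \<partial>M) (1 / p)"
proof -
  have "(\<integral>\<^sup>+x. epowr (g x * indicator B x) p \<partial>M) = (\<integral>\<^sup>+x\<in>B. epowr (g x) p \<partial>M)"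
    using p by (intro nn_integral_cong) (auto simp: indicator_def)
  then show ?thesis by (simp add: Lnorm_def)
qed

text \<open>The p-th power of the local norm is the mass of the ball for the density g^p, which
  reduces the claim to \<open>emeasure_ball_measurable\<close>.\<close>

lemma Lnorm_ball_measurable:
  fixes M :: "'a::metric_space measure"
  assumes g [measurable]: "g \<in> borel_measurable M" and sub: "sets borel \<subseteq> sets M" and p: "0 < p"
  shows "(\<lambda>y. Lnorm (ereal p) M (\<lambda>x. g x * indicator (ball y r) x)) \<in> borel_measurable borel"
proof -
  have B: "ball y r \<in> sets M" for y using sub borel_open[OF open_ball[of y r]] by blast
  have "Lnorm (ereal p) M (\<lambda>x. g x * indicator (ball y r) x)
      = epowr (emeasure (density M (\<lambda>x. epowr (g x) p)) (ball y r)) (1 / p)" for y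
    using B p by (simp add: Lnorm_indicator emeasure_density)
  moreover have "(\<lambda>y. emeasure (density M (\<lambda>x. epowr (g x) p)) (ball y r)) \<in> borel_measurable borel"
    using sub by (intro emeasure_ball_measurable) simp
  ultimately show ?thesis by simp
qed

text \<open>For s = \<infinity> the geometric factors are simply at most 1. For finite s the
  supremum of s-th powers is bounded by their sum, so integration term by term gives a geometric
  series and Minkowski's inequality is avoided. The constant precedes G, F and N, hence serves all
  radii and all f.\<close>

lemma Lnorm_geometric_SUP:
  fixes s :: ereal and \<epsilon> c :: real
  assumes s: "0 < s" and \<epsilon>: "0 < \<epsilon>" "\<epsilon> < 1" and c: "0 < c"
  shows "\<exists>K>0. \<forall>G F N. G \<in> borel_measurable M \<longrightarrow> (\<forall>k. F k \<in> borel_measurable M) \<longrightarrow>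
    (\<forall>y. G y \<le> ennreal c * (SUP k. ennreal (\<epsilon> ^ Suc k) * F k y)) \<longrightarrow>
    (\<forall>k. Lnorm s M (F k) \<le> N) \<longrightarrow> Lnorm s M G \<le> ennreal K * N"
proof (cases "s = \<infinity>")
  case True
  have "Lnorm s M G \<le> ennreal c * N"
    if [measurable]: "G \<in> borel_measurable M" "\<And>k. F k \<in> borel_measurable M"
      and G: "\<And>y. G y \<le> ennreal c * (SUP k. ennreal (\<epsilon> ^ Suc k) * F k y)"
      and F: "\<And>k::nat. Lnorm s M (F k) \<le> N" for G F N
  proof -
    have "AE y in M. F k y \<le> N" for k
      using esssup_AE[of "F k" M] F[of k] True by (auto simp: Lnorm_def elim: eventually_mono)
    then have "AE y in M. \<forall>k. F k y \<le> N" by (simp add: AE_all_countable)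
    then have "AE y in M. G y \<le> ennreal c * N"
    proof eventually_elim
      fix y assume y: "\<forall>k. F k y \<le> N"
      have "(SUP k. ennreal (\<epsilon> ^ Suc k) * F k y) \<le> N"
      proof (rule SUP_least)
        fix k
        have "\<epsilon> ^ Suc k \<le> 1" using \<epsilon> by (intro power_le_one) auto
        then have "ennreal (\<epsilon> ^ Suc k) * F k y \<le> 1 * N"
          by (intro mult_mono) (use y in auto)
        then show "ennreal (\<epsilon> ^ Suc k) * F k y \<le> N" by simp
      qed
      then show "G y \<le> ennreal c * N" by (intro order.trans[OF G] mult_left_mono) auto
    qed
    then show ?thesis using True by (auto simp: Lnorm_def intro: esssup_I)
  qed
  then show ?thesis using c by blast
next
  case False
  define t where "t = real_of_ereal s"
  have st: "s = ereal t" and t: "0 < t" using s False by (cases s; simp add: t_def)+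
  \<comment> \<open>The ratio of the geometric series after passing to t-th powers; undoing the
    power of its sum 1/(1-d) gives \<open>K\<close>.\<close>
  define d where "d = \<epsilon> powr t"
  have d: "0 < d" "d < 1" using \<epsilon> t using powr_less_mono2[of t \<epsilon> 1] by (auto simp: d_def)
  define K where "K = c * (1 / (1 - d)) powr (1 / t)"
  have K: "0 < K" using c d by (simp add: K_def)
  have "Lnorm s M G \<le> ennreal K * N"
    if [measurable]: "G \<in> borel_measurable M" "\<And>k. F k \<in> borel_measurable M"
      and G: "\<And>y. G y \<le> ennreal c * (SUP k. ennreal (\<epsilon> ^ Suc k) * F k y)"
      and F: "\<And>k::nat. Lnorm s M (F k) \<le> N" for G F N
  proof -
    have FN: "(\<integral>\<^sup>+y. epowr (F k y) t \<partial>M) \<le> epowr N t" for k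
      using F[of k] t epowr_le_iff[of "1 / t" "\<integral>\<^sup>+y. epowr (F k y) t \<partial>M" N]
      by (simp add: Lnorm_def st)
    have dk: "epowr (ennreal (\<epsilon> ^ Suc k)) t = ennreal (d ^ Suc k)" for k
    proof -
      have "(\<epsilon> ^ Suc k) powr t = d ^ Suc k"
        unfolding d_def powr_realpow[OF \<epsilon>(1), symmetric] powr_realpow[OF d(1)[unfolded d_def], symmetric]
        by (simp only: powr_powr mult.commute)
      then show ?thesis using \<epsilon> by (subst epowr_ennreal_pos) auto
    qed
    have "(\<integral>\<^sup>+y. epowr (G y) t \<partial>M) \<le>
       (\<integral>\<^sup>+y. ennreal (c powr t) * (\<Sum>k. ennreal (d ^ Suc k) * epowr (F k y) t) \<partial>M)"
    proof (rule nn_integral_mono)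
      fix y
      have "epowr (G y) t \<le> epowr (ennreal c * (SUP k. ennreal (\<epsilon> ^ Suc k) * F k y)) t"
        using t by (intro epowr_mono G) simp
      also have "\<dots> = ennreal (c powr t) * (SUP k. ennreal (d ^ Suc k) * epowr (F k y) t)"
        using t c by (simp add: epowr_mult epowr_SUP epowr_ennreal dk del: power_Suc)
      also have "\<dots> \<le> ennreal (c powr t) * (\<Sum>k. ennreal (d ^ Suc k) * epowr (F k y) t)"
      proof (intro mult_left_mono SUP_least)
        fix k
        show "ennreal (d ^ Suc k) * epowr (F k y) t \<le> (\<Sum>k. ennreal (d ^ Suc k) * epowr (F k y) t)"
          using sum_le_suminf[OF summableI, of "{k}" "\<lambda>k. ennreal (d ^ Suc k) * epowr (F k y) t"] by simp
      qed simp
      finally show "epowr (G y) t \<le> ennreal (c powr t) * (\<Sum>k. ennreal (d ^ Suc k) * epowr (F k y) t)" .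
    qed
    also have "\<dots> = ennreal (c powr t) * (\<Sum>k. ennreal (d ^ Suc k) * (\<integral>\<^sup>+y. epowr (F k y) t \<partial>M))"
      by (simp add: nn_integral_cmult nn_integral_suminf del: power_Suc)
    also have "\<dots> \<le> ennreal (c powr t) * (\<Sum>k. ennreal (d ^ k) * epowr N t)"
    proof (intro mult_left_mono suminf_le mult_mono FN summableI ennreal_leI)
      show "d ^ Suc k \<le> d ^ k" for k using d by (intro power_decreasing) auto
    qed auto
    also have "(\<Sum>k. ennreal (d ^ k) * epowr N t) = ennreal (1 / (1 - d)) * epowr N t"
    proof -
      have "(\<Sum>k. ennreal (d ^ k)) = ennreal (1 / (1 - d))"
        by (rule suminf_ennreal_eq) (use d in \<open>auto intro!: geometric_sums\<close>)
      then show ?thesis by simp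
    qed
    finally have "(\<integral>\<^sup>+y. epowr (G y) t \<partial>M) \<le> ennreal (c powr t * (1 / (1 - d))) * epowr N t"
      using d by (simp add: ennreal_mult' mult.assoc del: times_divide_eq_right)
    also have "c powr t * (1 / (1 - d)) = K powr t"
      using c d t by (simp add: K_def powr_mult powr_powr del: times_divide_eq_right)
    also have "ennreal (K powr t) * epowr N t = epowr (ennreal K * N) t"
      using t K by (simp add: epowr_mult epowr_ennreal)
    finally show ?thesis using t by (simp add: Lnorm_def st epowr_le_iff)
  qed
  then show ?thesis using K by blast
qed

section \<open>From the class condition to positive weights with finite ball masses\<close>

lemma locally_integrable_measurable:
  fixes f :: "real ^ 'n \<Rightarrow> real"
  assumes "locally_integrable f"
  shows "f \<in> borel_measurable lebesgue"
proof (rule borel_measurable_LIMSEQ_real)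
  show "(\<lambda>x. indicator (cball 0 (real n)) x *\<^sub>R f x) \<in> borel_measurable lebesgue" for n
    using assms unfolding locally_integrable_def set_integrable_def
    by (intro borel_measurable_integrable) auto
  fix x :: "real ^ 'n"
  obtain n0 where "norm x \<le> real n0" using real_arch_simple by blast
  then have "\<forall>\<^sub>F n in sequentially. indicator (cball 0 (real n)) x *\<^sub>R f x = f x"
    by (intro eventually_sequentiallyI[of n0]) (auto simp: indicator_def)
  then show "(\<lambda>n. indicator (cball 0 (real n)) x *\<^sub>R f x) \<longlonglongrightarrow> f x"
    by (rule tendsto_eventually)
qed

lemma AE_lebesgue_ballI:
  fixes P :: "real ^ 'n \<Rightarrow> bool"
  assumes "\<And>r. 0 < r \<Longrightarrow> AE x in lebesgue. x \<in> ball 0 r \<longrightarrow> P x"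
  shows "AE x in lebesgue. P x"
proof -
  have "AE x in lebesgue. \<forall>n. x \<in> ball 0 (real (Suc n)) \<longrightarrow> P x"
    unfolding AE_all_countable by (intro allI assms) simp
  then show ?thesis
  proof eventually_elim
    fix x assume x: "\<forall>n. x \<in> ball 0 (real (Suc n)) \<longrightarrow> P x"
    obtain n where "norm x < real n" using reals_Archimedean2 by blast
    then have "x \<in> ball 0 (real (Suc n))" by simp
    with x show "P x" by blast
  qed
qed

text \<open>If \<open>w\<close> does not vanish almost everywhere, then \<open>w\<^sup>q\<close> has positive mass on all large balls, so
  that finiteness of the product in the class forces \<open>w\<close> to the power \<open>-p'\<close> to be locally integrable
  and hence \<open>w > 0\<close> almost everywhere.\<close>

lemma A_class_cases:
  fixes w :: "real ^ 'n \<Rightarrow> real"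
  assumes pars: "0 < \<gamma>" "\<gamma> < real CARD('n)" "1 < p" "p < real CARD('n) / \<gamma>"
      "1 / q = 1 / p - \<gamma> / real CARD('n)"
    and A: "A_class p q w"
  shows "(AE x in lebesgue. w x = 0) \<or> (\<exists>C. Apq_weight w \<gamma> p q (p / (p - 1)) C)"
proof (cases "AE x in lebesgue. w x = 0")
  case nz: False
  define p' where "p' = p / (p - 1)"
  have p': "0 < p'" using pars by (simp add: p'_def)
  have "\<gamma> / real CARD('n) < 1 / p" using pars by (simp add: field_simps)
  then have "0 < 1 / q" using pars by simp
  then have q: "0 < q" by simp
  let ?U = "weight_measure (\<lambda>x. w x powr q)" and ?V = "weight_measure (\<lambda>x. w x powr (- p'))"
  have w0: "0 \<le> w x" and w [measurable]: "w \<in> borel_measurable lebesgue" for x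
    using A by (auto simp: A_class_def weight_def locally_integrable_measurable)
  define S where "S B = (\<integral>\<^sup>+x\<in>B. epowr (ennreal (w x)) (- p') \<partial>lebesgue)" for B
  obtain C where C: "0 < C" "\<And>c r. 0 < r \<Longrightarrow>
     epowr ((\<integral>\<^sup>+x\<in>ball c r. epowr (ennreal (w x)) q \<partial>lebesgue) / emeasure lebesgue (ball c r)) (1 / q)
     * epowr (S (ball c r) / emeasure lebesgue (ball c r)) (1 / p') \<le> ennreal C"
    using A unfolding A_class_def S_def p'_def Let_def by auto
  have U: "(\<integral>\<^sup>+x\<in>B. epowr (ennreal (w x)) q \<partial>lebesgue) = emeasure ?U B" if "B \<in> sets lebesgue" for B
    using that w0 q by (simp add: emeasure_weight_measure epowr_ennreal)
  have "\<exists>r0>0. emeasure ?U (ball 0 r0) \<noteq> 0"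
  proof (rule ccontr)
    assume *: "\<not> ?thesis"
    have "AE x in lebesgue. w x = 0"
    proof (rule AE_lebesgue_ballI)
      fix r :: real assume "0 < r"
      have [measurable]: "ball (0 :: real ^ 'n) r \<in> sets lebesgue" by simp
      from \<open>0 < r\<close> have "(\<integral>\<^sup>+x. ennreal (w x powr q) * indicator (ball 0 r) x \<partial>lebesgue) = 0"
        using * by (simp add: emeasure_weight_measure)
      then have "AE x in lebesgue. ennreal (w x powr q) * indicator (ball 0 r) x = 0"
        by (rule nn_integral_0_iff_AE[THEN iffD1, rotated]) measurable
      then show "AE x in lebesgue. x \<in> ball 0 r \<longrightarrow> w x = 0"
      proof eventually_elim
        case (elim x)
        then show ?case by (cases "x \<in> ball 0 r") (auto simp: ennreal_eq_0_iff)
      qed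
    qed
    with nz show False by simp
  qed
  then obtain r0 where r0: "0 < r0" "emeasure ?U (ball 0 r0) \<noteq> 0" by blast
  \<comment> \<open>A real-valued weight is never \<infinity>, so its negative power never vanishes;
    hence \<open>S\<close> is nonzero on every ball.\<close>
  have Spos: "epowr (ennreal (w x)) (- p') \<noteq> 0" for x
    using w0[of x] p' by (auto simp: epowr_def)
  have S_nz: "S (ball c r) \<noteq> 0" if "0 < r" for c r
  proof
    assume 0: "S (ball c r) = 0"
    have [measurable]: "ball c r \<in> sets lebesgue" by simp
    from 0 have "AE x in lebesgue. epowr (ennreal (w x)) (- p') * indicator (ball c r) x = 0"
      unfolding S_def by (rule nn_integral_0_iff_AE[THEN iffD1, rotated]) measurable
    then have "AE x in lebesgue. x \<notin> ball c r"
      by eventually_elim (use Spos in \<open>auto simp: indicator_def split: if_splits\<close>)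
    then have "emeasure lebesgue (ball c r) = 0"
      by (subst (asm) AE_iff_measurable[of "ball c r"]) auto
    then show False using measure_lebesgue_ball_pos[OF that, of c] by (simp add: measure_def)
  qed
  have big: "emeasure ?U (ball c r) \<noteq> \<infinity> \<and> S (ball c r) \<noteq> \<infinity>" if r: "0 < r" for c r
  proof -
    \<comment> \<open>A centred ball containing both the given ball and one of positive
      \<open>U\<close>-mass; finiteness there passes down by monotonicity.\<close>
    define R where "R = max r0 (norm c + r)"
    have R: "0 < R" using r0 by (simp add: R_def)
    have sub: "ball 0 r0 \<subseteq> ball 0 R" "ball c r \<subseteq> ball 0 R"
      using norm_triangle_ineq[of c "_ - c"] dist_norm[of c] by (auto simp: R_def dist_norm norm_minus_commute)
        (smt (verit) norm_triangle_sub norm_minus_commute)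
    have "emeasure ?U (ball 0 r0) \<le> emeasure ?U (ball 0 R)" by (intro emeasure_mono sub) simp
    then have Unz: "emeasure ?U (ball 0 R) \<noteq> 0" using r0 by auto
    let ?m = "emeasure lebesgue (ball (0::real ^ 'n) R)"
    obtain m where "?m = ennreal m" "0 < m"
      using emeasure_lebesgue_ball_eq[OF R] measure_lebesgue_ball_pos[OF R] by blast
    then have m: "?m \<noteq> 0" "?m \<noteq> \<infinity>" by (simp_all del: emeasure_completion)
    have nz: "epowr (x / ?m) (1 / t) \<noteq> 0" "x = \<infinity> \<Longrightarrow> epowr (x / ?m) (1 / t) = \<infinity>"
      if "x \<noteq> 0" "0 < t" for x t
      using that m by (auto simp: epowr_def ennreal_divide_eq_0_iff ennreal_top_divide infinity_ennreal_def
           enn2real_eq_0_iff ennreal_divide_eq_top_iff)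
    \<comment> \<open>With 0 * \<infinity> = 0, a finite product bounds each factor only if the
      other is nonzero, which both are on this ball.\<close>
    have fin: "epowr (emeasure ?U (ball 0 R) / ?m) (1 / q) * epowr (S (ball 0 R) / ?m) (1 / p') \<noteq> \<infinity>"
      using C(2)[OF R, of 0] by (auto simp: U top_unique infinity_ennreal_def simp del: emeasure_completion)
    have "emeasure ?U (ball 0 R) \<noteq> \<infinity>"
      using fin nz(1)[OF S_nz[OF R] p'] nz(2)[OF Unz q] by (auto simp: ennreal_mult_eq_top_iff infinity_ennreal_def)
    moreover have "S (ball 0 R) \<noteq> \<infinity>"
      using fin nz(1)[OF Unz q] nz(2)[OF S_nz[OF R] p'] by (auto simp: ennreal_mult_eq_top_iff infinity_ennreal_def)
    moreover have "emeasure ?U (ball c r) \<le> emeasure ?U (ball 0 R)" by (intro emeasure_mono sub) simp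
    moreover have "S (ball c r) \<le> S (ball 0 R)"
      unfolding S_def by (intro nn_integral_mono) (use sub in \<open>auto simp: indicator_def\<close>)
    ultimately show ?thesis by (auto simp: infinity_ennreal_def top_unique)
  qed
  have wpos: "AE x in lebesgue. 0 < w x"
  proof (rule AE_lebesgue_ballI)
    fix r :: real assume r: "0 < r"
    have [measurable]: "ball (0 :: real ^ 'n) r \<in> sets lebesgue" by simp
    have "AE x in lebesgue. epowr (ennreal (w x)) (- p') * indicator (ball 0 r) x \<noteq> \<infinity>"
    proof (rule nn_integral_PInf_AE)
      show "(\<integral>\<^sup>+x\<in>ball 0 r. epowr (ennreal (w x)) (- p') \<partial>lebesgue) \<noteq> \<infinity>"
        using big[OF r, of 0] by (simp add: S_def)
    qed measurable
    then show "AE x in lebesgue. x \<in> ball 0 r \<longrightarrow> 0 < w x"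
    proof eventually_elim
      case (elim x)
      then show ?case using w0[of x] p' by (cases "w x = 0") (auto simp: epowr_def)
    qed
  qed
  have V: "S B = emeasure ?V B" if "B \<in> sets lebesgue" for B
  proof -
    have "S B = (\<integral>\<^sup>+x\<in>B. ennreal (w x powr (- p')) \<partial>lebesgue)"
      unfolding S_def by (rule nn_integral_cong_AE, use wpos in eventually_elim) (simp add: epowr_ennreal_pos)
    then show ?thesis using that by (simp add: emeasure_weight_measure)
  qed
  have "Apq_weight w \<gamma> p q p' C"
  proof
    fix c :: "real ^ 'n" and r :: real assume r: "0 < r"
    show Uf: "emeasure ?U (ball c r) \<noteq> \<infinity>" using big[OF r] by simp
    show Vf: "emeasure ?V (ball c r) \<noteq> \<infinity>" using big[OF r, of c] by (simp add: V)
    let ?m = "measure lebesgue (ball c r)" and ?u = "measure ?U (ball c r)" and ?v = "measure ?V (ball c r)"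
    have m: "0 < ?m" by (rule measure_lebesgue_ball_pos[OF r])
    have e: "emeasure ?U (ball c r) = ennreal ?u" "emeasure ?V (ball c r) = ennreal ?v"
      using Uf Vf by (auto simp: emeasure_eq_ennreal_measure infinity_ennreal_def)
    have "ennreal ((?u / ?m) powr (1 / q) * (?v / ?m) powr (1 / p')) =
       epowr (emeasure ?U (ball c r) / emeasure lebesgue (ball c r)) (1 / q)
       * epowr (S (ball c r) / emeasure lebesgue (ball c r)) (1 / p')"
      unfolding V[OF lmeasurable_ball[THEN fmeasurableD]] e emeasure_lebesgue_ball_eq[OF r]
      using m q p' by (simp add: divide_ennreal epowr_ennreal ennreal_mult)
    also have "\<dots> \<le> ennreal C" using C(2)[OF r, of c] by (simp add: U del: emeasure_completion)
    finally have bound: "(?u / ?m) powr (1 / q) * (?v / ?m) powr (1 / p') \<le> C"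
      using C(1) by (simp add: ennreal_le_iff)
    have "1 - \<gamma> / real CARD('n) = 1 / q + 1 / p'"
      using pars by (simp add: p'_def field_simps)
    then have eq: "?m powr (1 - \<gamma> / real CARD('n)) = ?m powr (1 / q) * ?m powr (1 / p')"
      by (simp only: powr_add)
    show "?u powr (1 / q) * ?v powr (1 / p') \<le> C * ?m powr (1 - \<gamma> / real CARD('n))"
      unfolding eq using bound m by (simp add: powr_divide field_simps)
  qed (use pars C wpos in \<open>auto simp: p'_def\<close>)
  then show ?thesis by (auto simp: p'_def)
qed simp

section \<open>The amalgam estimate and the degenerate weight\<close>

context Apq_weight
begin

text \<open>For each radius the claim reduces to a comparison at every centre y: the function on the
  left is at most a constant times the supremum of \<epsilon>^(k+1) times the corresponding function
  for f at radius 2^(k+1) r, with \<epsilon> = \<delta>^\<eta> from reverse doubling.\<close>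

lemma frac_maximal_amalgam_bound:
  fixes \<mu> :: "real ^ 'n \<Rightarrow> real" and \<alpha> \<beta> :: real and s :: ereal
  assumes \<alpha>: "p \<le> \<alpha>" "\<alpha> < \<beta>" "ereal \<beta> < s" and \<beta>: "1 / \<beta> = 1 / \<alpha> - \<gamma> / real CARD('n)"
  shows "\<exists>K::real>0. \<forall>f \<in> borel_measurable lebesgue.
      amalgam_norm q s \<beta> (\<lambda>x. w x powr q) (\<lambda>x. w x powr q) \<mu> (frac_maximal \<gamma> f)
        \<le> ennreal K * amalgam_norm p s \<alpha> (\<lambda>x. w x powr p) (\<lambda>x. w x powr q) \<mu> (\<lambda>x. ennreal \<bar>f x\<bar>)"
proof -
  define \<sigma> where "\<sigma> = real_of_ereal (1 / s)"
  define e where "e = 1 / \<alpha> - 1 / p - \<sigma>"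
  define \<eta> where "\<eta> = 1 / \<beta> - \<sigma>"
  have \<beta>pos: "0 < \<beta>" using \<alpha> p by simp
  have \<eta>: "0 < \<eta>"
  proof (cases s)
    case (real t)
    then have "1 / t < 1 / \<beta>" using \<alpha>(3) \<beta>pos by (simp add: field_simps)
    moreover have "\<sigma> = 1 / t" using real \<alpha>(3) \<beta>pos by (simp add: \<sigma>_def one_ereal_def)
    ultimately show ?thesis by (simp add: \<eta>_def)
  qed (use \<alpha>(3) \<beta>pos in \<open>simp_all add: \<eta>_def \<sigma>_def\<close>)
  have s: "0 < s" using \<alpha>(3) \<beta>pos by (metis ereal_less(2) less_trans)
  have e1: "1 / \<beta> - 1 / q - \<sigma> = e" using \<beta> q_eq by (simp add: e_def)
  have e2: "e + 1 / q = \<eta>" using e1 by (simp add: \<eta>_def)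
  obtain \<delta> where \<delta>: "0 < \<delta>" "\<delta> < 1" "\<And>c r. 0 < r \<Longrightarrow> measure U (ball c r) \<le> \<delta> * measure U (ball c (2 * r))"
    using U_reverse_doubling by blast
  obtain K where K: "0 < K" "\<And>f y r. f \<in> borel_measurable lebesgue \<Longrightarrow> 0 < r \<Longrightarrow>
    (\<integral>\<^sup>+x\<in>ball y r. epowr (frac_maximal \<gamma> f x) q \<partial>U) \<le> ennreal K *
      (SUP k. ennreal (measure U (ball y r) / measure U (ball y (2 ^ Suc k * r))) *
        epowr (\<integral>\<^sup>+z\<in>ball y (2 ^ Suc k * r). ennreal (\<bar>f z\<bar> powr p) \<partial>W) (q / p))"
    using frac_maximal_ball_estimate by blast
  define \<epsilon> where "\<epsilon> = \<delta> powr \<eta>"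
  have \<epsilon>: "0 < \<epsilon>" "\<epsilon> < 1" using \<delta> \<eta> powr_less_mono2[of \<eta> \<delta> 1] by (auto simp: \<epsilon>_def)
  define c where "c = K powr (1 / q)"
  have c: "0 < c" using K by (simp add: c_def)
  obtain K' where K': "0 < K'" "\<And>G F N. G \<in> borel_measurable (weight_measure \<mu>) \<Longrightarrow>
    (\<And>k. F k \<in> borel_measurable (weight_measure \<mu>)) \<Longrightarrow>
    (\<And>y. G y \<le> ennreal c * (SUP k. ennreal (\<epsilon> ^ Suc k) * F k y)) \<Longrightarrow>
    (\<And>k. Lnorm s (weight_measure \<mu>) (F k) \<le> N) \<Longrightarrow> Lnorm s (weight_measure \<mu>) G \<le> ennreal K' * N"
    using Lnorm_geometric_SUP[OF s \<epsilon> c, where M = "weight_measure \<mu>"] by (elim exE conjE) blast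
  have meas: "(\<lambda>y. epowr (emeasure U (ball y r)) a * Lnorm (ereal b) M (\<lambda>x. g x * indicator (ball y r) x))
      \<in> borel_measurable (weight_measure \<mu>)"
    if [measurable]: "g \<in> borel_measurable lebesgue" and M: "sets M = sets lebesgue" and b: "0 < b"
    for r a b g and M :: "(real ^ 'n) measure"
  proof -
    have sub: "sets borel \<subseteq> sets (lebesgue :: (real ^ 'n) measure)" by auto
    have [measurable]: "(\<lambda>y. emeasure U (ball y r)) \<in> borel_measurable borel"
      by (rule emeasure_ball_measurable) (simp add: sub)
    have [measurable]: "(\<lambda>y. Lnorm (ereal b) M (\<lambda>x. g x * indicator (ball y r) x)) \<in> borel_measurable borel"
      by (rule Lnorm_ball_measurable) (use b M sub in \<open>simp_all add: measurable_cong_sets[OF M refl]\<close>)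
    have "(\<lambda>y. epowr (emeasure U (ball y r)) a * Lnorm (ereal b) M (\<lambda>x. g x * indicator (ball y r) x))
      \<in> borel_measurable borel" by measurable
    then show ?thesis
      by (simp add: measurable_cong_sets[OF sets_weight_measure refl] measurable_completion)
  qed
  have "amalgam_norm q s \<beta> (\<lambda>x. w x powr q) (\<lambda>x. w x powr q) \<mu> (frac_maximal \<gamma> f)
        \<le> ennreal K' * amalgam_norm p s \<alpha> (\<lambda>x. w x powr p) (\<lambda>x. w x powr q) \<mu> (\<lambda>x. ennreal \<bar>f x\<bar>)"
    (is "_ \<le> ennreal K' * ?N") if f [measurable]: "f \<in> borel_measurable lebesgue" for f
    unfolding amalgam_norm_def[of q] e1[unfolded \<sigma>_def]
  proof (rule SUP_least)
    fix r :: real assume "r \<in> {0<..}"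
    then have r: "0 < r" by simp
    let ?G = "\<lambda>y. epowr (emeasure U (ball y r)) e * Lnorm (ereal q) U (\<lambda>x. frac_maximal \<gamma> f x * indicator (ball y r) x)"
    let ?F = "\<lambda>k y. epowr (emeasure U (ball y (2 ^ Suc k * r))) e *
       Lnorm (ereal p) W (\<lambda>x. ennreal \<bar>f x\<bar> * indicator (ball y (2 ^ Suc k * r)) x)"
    show "Lnorm s (weight_measure \<mu>) ?G \<le> ennreal K' * ?N"
    proof (rule K'(2))
      show "?G \<in> borel_measurable (weight_measure \<mu>)"
        by (rule meas) (use q_pos in auto)
      show "?F k \<in> borel_measurable (weight_measure \<mu>)" for k
        by (rule meas) (use p in auto)
      show "Lnorm s (weight_measure \<mu>) (?F k) \<le> ?N" for k
        unfolding amalgam_norm_def e_def \<sigma>_def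
        by (rule SUP_upper2[of "2 ^ Suc k * r"]) (use r in auto)
      show "?G y \<le> ennreal c * (SUP k. ennreal (\<epsilon> ^ Suc k) * ?F k y)" for y
      proof -
        define J where "J k = (\<integral>\<^sup>+z\<in>ball y (2 ^ Suc k * r). ennreal (\<bar>f z\<bar> powr p) \<partial>W)" for k
        define uu where "uu = measure U (ball y r)"
        define ub where "ub k = measure U (ball y (2 ^ Suc k * r))" for k
        have r': "0 < 2 ^ Suc k * r" for k using r by simp
        have upos: "0 < uu" "\<And>k. 0 < ub k" using r by (auto simp: uu_def ub_def intro!: U_pos)
        have LF: "Lnorm (ereal p) W (\<lambda>x. ennreal \<bar>f x\<bar> * indicator (ball y (2 ^ Suc k * r)) x) = epowr (J k) (1 / p)" for k
          using p by (subst Lnorm_indicator) (auto simp: epowr_ennreal J_def)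
        have "Lnorm (ereal q) U (\<lambda>x. frac_maximal \<gamma> f x * indicator (ball y r) x) =
           epowr (\<integral>\<^sup>+x\<in>ball y r. epowr (frac_maximal \<gamma> f x) q \<partial>U) (1 / q)"
          using q_pos by (intro Lnorm_indicator) auto
        also have "\<dots> \<le> epowr (ennreal K * (SUP k. ennreal (uu / ub k) * epowr (J k) (q / p))) (1 / q)"
          unfolding uu_def ub_def J_def using q_pos by (intro epowr_mono K f r) auto
        also have "\<dots> = ennreal c * (SUP k. ennreal ((uu / ub k) powr (1 / q)) * epowr (J k) (1 / p))"
          using K(1) q_pos p upos(1) upos(2)[THEN less_imp_le]
          by (simp add: epowr_mult epowr_SUP epowr_ennreal epowr_epowr c_def)
        finally have "?G y \<le> ennreal (uu powr e) * (ennreal c * (SUP k. ennreal ((uu / ub k) powr (1 / q)) * epowr (J k) (1 / p)))"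
          unfolding U_eq[OF r] uu_def[symmetric] epowr_ennreal_pos[OF upos(1)] by (rule mult_left_mono) simp
        also have "\<dots> = ennreal c * (SUP k. ennreal (uu powr e) * (ennreal ((uu / ub k) powr (1 / q)) * epowr (J k) (1 / p)))"
          by (simp add: SUP_mult_left_ennreal mult.left_commute)
        also have "\<dots> \<le> ennreal c * (SUP k. ennreal (\<epsilon> ^ Suc k) * ?F k y)"
        proof (intro mult_left_mono SUP_mono bexI)
          fix k
          have "uu / ub k \<le> \<delta> ^ Suc k"
            using U_dilate[OF \<delta>(1,3) r, of y "Suc k"] upos(2)[of k]
            by (simp add: uu_def ub_def divide_le_eq)
          then have "(uu / ub k) powr \<eta> \<le> (\<delta> ^ Suc k) powr \<eta>"
            using \<eta> upos(1) upos(2)[of k] by (intro powr_mono2) auto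
          also have "\<dots> = \<epsilon> ^ Suc k"
            unfolding \<epsilon>_def powr_realpow[OF \<delta>(1), symmetric] powr_realpow[OF \<epsilon>(1)[unfolded \<epsilon>_def], symmetric]
            by (simp only: powr_powr mult.commute)
          finally have "(uu / ub k) powr \<eta> * ub k powr e \<le> \<epsilon> ^ Suc k * ub k powr e"
            by (rule mult_right_mono) simp
          \<comment> \<open>Since \<eta> = e + 1/q, the power e of the ratio exchanges the mass of
            the dilate for that of the original ball, and 1/q is the power left by the local
            estimate.\<close>
          moreover have "(uu / ub k) powr \<eta> * ub k powr e = uu powr e * (uu / ub k) powr (1 / q)"
            unfolding e2[symmetric] using upos(1) upos(2)[of k] by (simp add: powr_add powr_divide)
          ultimately have le: "uu powr e * (uu / ub k) powr (1 / q) \<le> \<epsilon> ^ Suc k * ub k powr e" by simp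
          have "ennreal (uu powr e) * (ennreal ((uu / ub k) powr (1 / q)) * epowr (J k) (1 / p))
             = ennreal (uu powr e * (uu / ub k) powr (1 / q)) * epowr (J k) (1 / p)"
            by (simp only: ennreal_mult''[OF powr_ge_zero] mult.assoc)
          also have "\<dots> \<le> ennreal (\<epsilon> ^ Suc k * ub k powr e) * epowr (J k) (1 / p)"
            by (intro mult_right_mono ennreal_leI le) simp
          also have "\<dots> = ennreal (\<epsilon> ^ Suc k) * ?F k y"
            unfolding LF U_eq[OF r'] ub_def[symmetric] epowr_ennreal_pos[OF upos(2)]
            by (simp only: ennreal_mult''[OF powr_ge_zero] mult.assoc)
          finally show "ennreal (uu powr e) * (ennreal ((uu / ub k) powr (1 / q)) * epowr (J k) (1 / p))
             \<le> ennreal (\<epsilon> ^ Suc k) * ?F k y" .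
        qed auto
        finally show ?thesis .
      qed
    qed
  qed
  with K'(1) show ?thesis by blast
qed

end

text \<open>The density vanishes almost everywhere, so every inner norm is 0. The power of a ball
  mass in front may be \<infinity>, but its product with 0 is still 0.\<close>

lemma amalgam_norm_null_weight:
  fixes w \<mu> :: "real ^ 'n \<Rightarrow> real"
  assumes w: "AE x in lebesgue. w x = 0" "w \<in> borel_measurable lebesgue" and q: "0 < q" and s: "0 < s"
  shows "amalgam_norm q s \<beta> (\<lambda>x. w x powr q) v \<mu> g = 0"
proof -
  have "AE x in weight_measure (\<lambda>x. w x powr q). False"
    unfolding weight_measure_def using w by (subst AE_density) (auto elim: eventually_mono)
  then have "(\<integral>\<^sup>+x. h x \<partial>weight_measure (\<lambda>x. w x powr q)) = (\<integral>\<^sup>+x. 0 \<partial>weight_measure (\<lambda>x. w x powr q))" for h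
    by (intro nn_integral_cong_AE) (auto elim: eventually_mono)
  then have L: "Lnorm (ereal q) (weight_measure (\<lambda>x. w x powr q)) h = 0" for h
    using q by (simp add: Lnorm_def)
  have "Lnorm s (weight_measure \<mu>) (\<lambda>_. 0) = 0"
  proof (cases "s = \<infinity>")
    case True
    have "esssup (weight_measure \<mu>) (\<lambda>_. 0::ennreal) \<le> 0" by (intro esssup_I) auto
    then show ?thesis using True by (simp add: Lnorm_def)
  next
    case False
    then have "0 < real_of_ereal s" using s by (cases s) auto
    then show ?thesis using False by (simp add: Lnorm_def)
  qed
  then show ?thesis unfolding amalgam_norm_def L by simp
qed

theorem corollary3p1:
  fixes w \<mu> :: "real ^ 'n \<Rightarrow> real" and \<gamma> p q \<alpha> \<beta> :: real and s :: ereal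
  assumes "0 < \<gamma>" and "\<gamma> < real CARD('n)"
    and "1 < p" and "p < real CARD('n) / \<gamma>"
    and "1 / q = 1 / p - \<gamma> / real CARD('n)"
    and "A_class p q w"
    and "p \<le> \<alpha>" and "\<alpha> < \<beta>" and "ereal \<beta> < s"
    and "1 / \<beta> = 1 / \<alpha> - \<gamma> / real CARD('n)"
    and "doubling_weight \<mu>"
  shows "\<exists>C::real>0.
    \<forall>f \<in> amalgam_space p s \<alpha> (\<lambda>x. w x powr p) (\<lambda>x. w x powr q) \<mu>.
      amalgam_norm q s \<beta> (\<lambda>x. w x powr q) (\<lambda>x. w x powr q) \<mu> (frac_maximal \<gamma> f)
        \<le> ennreal C * amalgam_norm p s \<alpha> (\<lambda>x. w x powr p) (\<lambda>x. w x powr q) \<mu>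
            (\<lambda>x. ennreal \<bar>f x\<bar>)"
proof -
  consider "AE x in lebesgue. w x = 0" | C where "Apq_weight w \<gamma> p q (p / (p - 1)) C"
    using A_class_cases[OF assms(1-6)] by blast
  then show ?thesis
  proof cases
    \<comment> \<open>The left side is 0 here, so the constant 1 serves.\<close>
    case 1
    have "\<gamma> / real CARD('n) < 1 / p" using assms(1-4) by (simp add: field_simps)
    then have "0 < 1 / q" using assms(5) by simp
    then have q: "0 < q" by simp
    have "0 < s" using assms(3,7,8,9) by (intro le_less_trans[OF _ assms(9)]) simp
    moreover have "w \<in> borel_measurable lebesgue"
      using assms(6) by (simp add: A_class_def weight_def locally_integrable_measurable)
    ultimately show ?thesis
      using amalgam_norm_null_weight[OF 1 _ q] by (intro exI[of _ 1]) simp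
  next
    case 2
    then interpret Apq_weight w \<gamma> p q "p / (p - 1)" C .
    show ?thesis
      using frac_maximal_amalgam_bound[OF assms(7-10), of \<mu>]
      by (auto simp: amalgam_space_def locally_integrable_measurable)
  qed
qed

end
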